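(* Let $L$ be a nilpotent subalgebra of rank $n$ over $R$ of the Lie algebra $W(A)$, let $Z=Z(L)$ be the center of $L$, and let $F$ be the field of constants of $L$ in $R$. If $\operatorname{rk}_R Z\ge n-2$, then the Lie algebra $FL$ over $F$ can be isomorphically embedded (as an abstract Lie algebra over $F$) into the triangular Lie algebra $u_n(F)$.
   Context: $\mathbb K$ is a field of characteristic zero, $A$ is an integral domain over $\mathbb K$ (a commutative $\mathbb K$-algebra without zero divisors), and $R=\operatorname{Frac}(A)$ is its field of fractions. $\operatorname{Der}_{\mathbb K}A$ is the Lie algebra over $\mathbb K$ of all $\mathbb K$-derivations of $A$ with bracket $[D_1,D_2]=D_1D_2-D_2D_1$; each derivation of $A$ extends uniquely to $R$, so $\operatorname{Der}_{\mathbb K}A\subseteq\operatorname{Der}_{\mathbb K}R$. $W(A):=R\operatorname{Der}_{\mathbb K}A$ (the $R$-linear span) is a subalgebra of the $\mathbb K$-Lie algebra $\operatorname{Der}_{\mathbb K}R$ (it is a Lie algebra over $\mathbb K$, not over $R$, but it is a vector space over $R$). For a subalgebra $L\subseteq W(A)$ (or a subset such as its center), $\operatorname{rk}_R L:=\dim_R RL$, where $RL$ is the $R$-linear span. The field of constants of $L$ in $R$ is $F=F(L)=\{r\in R \mid D(r)=0 \text{ for all } D\in L\}$. $FL$ is the $F$-linear span of $L$; it is a Lie algebra over $F$. For a field $F$ of characteristic zero and an integer $n\ge 1$, the triangular Lie algebra $u_n(F)$ is the subalgebra of the Lie algebra $\operatorname{Der}_F F[x_1,\dots,x_n]$ consisting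 of all derivations of the form $$D=f_1(x_2,\dots,x_n)\frac{\partial}{\partial x_1}+\dots+f_{n-1}(x_n)\frac{\partial}{\partial x_{n-1}}+f_n\frac{\partial}{\partial x_n},$$ where $f_i\in F[x_{i+1},\dots,x_n]$ for $i=1,\dots,n-1$ and $f_n\in F$. *)

theory Defs
  imports
    "HOL-Computational_Algebra.Polynomial_Factorial"
    "HOL-Library.Function_Algebras"
    "HOL-Library.Poly_Mapping"
begin

section \<open>The ground field, the domain, and its field of fractions\<close>

text \<open>
  The domain \<open>A\<close> is the type \<^typ>\<open>'a::idom\<close>, the ground field \<open>K\<close> is the type
  \<^typ>\<open>'k::field_char_0\<close>, and the \<open>K\<close>-algebra structure is the scalar multiplication \<open>sc\<close>.
  The field \<open>R\<close> is \<^typ>\<open>'a fract\<close>.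
\<close>

locale algebra_over_field = vector_space sc
  for sc :: "'k::field_char_0 \<Rightarrow> 'a::idom \<Rightarrow> 'a" +
  assumes scale_mult_left: "sc c (x * y) = sc c x * y"

definition fract_scale :: "('k \<Rightarrow> 'a::idom \<Rightarrow> 'a) \<Rightarrow> 'k \<Rightarrow> 'a fract \<Rightarrow> 'a fract" where
  "fract_scale sc c r = to_fract (sc c 1) * r"

section \<open>Derivations\<close>

text \<open>
  Derivations of an algebra with carrier \<open>B\<close>, linear over the scalars in \<open>S\<close> acting by \<open>sc\<close>.
  They are made to vanish off \<open>B\<close>, so that each derivation of \<open>B\<close> is represented by exactly one
  function.  Sums and scalar multiples of such functions, and their commutators, vanish off \<open>B\<close> too.
\<close>

definition derivations ::
  "'s set \<Rightarrow> ('s \<Rightarrow> 'b \<Rightarrow> 'b) \<Rightarrow> 'b::comm_ring_1 set \<Rightarrow> ('b \<Rightarrow> 'b) set" where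
  "derivations S sc B = {D.
     (\<forall>x\<in>B. D x \<in> B) \<and> (\<forall>x. x \<notin> B \<longrightarrow> D x = 0) \<and>
     (\<forall>x\<in>B. \<forall>y\<in>B. D (x + y) = D x + D y) \<and>
     (\<forall>c\<in>S. \<forall>x\<in>B. D (sc c x) = sc c (D x)) \<and>
     (\<forall>x\<in>B. \<forall>y\<in>B. D (x * y) = D x * y + x * D y)}"

definition lie_bracket :: "('b \<Rightarrow> 'b) \<Rightarrow> ('b \<Rightarrow> 'b) \<Rightarrow> 'b \<Rightarrow> 'b::ab_group_add" where
  "lie_bracket D E = (\<lambda>x. D (E x) - E (D x))"

definition pointwise_mult :: "'b \<Rightarrow> ('b \<Rightarrow> 'b) \<Rightarrow> 'b \<Rightarrow> 'b::comm_ring_1" where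
  "pointwise_mult r D = (\<lambda>x. r * D x)"

interpretation fract_op: vector_space
  "pointwise_mult :: 'a::idom fract \<Rightarrow> ('a fract \<Rightarrow> 'a fract) \<Rightarrow> 'a fract \<Rightarrow> 'a fract"
  by unfold_locales (auto simp: pointwise_mult_def fun_eq_iff algebra_simps)

definition ground_scale ::
  "('k \<Rightarrow> 'a::idom \<Rightarrow> 'a) \<Rightarrow> 'k \<Rightarrow> ('a fract \<Rightarrow> 'a fract) \<Rightarrow> 'a fract \<Rightarrow> 'a fract" where
  "ground_scale sc c D = (\<lambda>x. fract_scale sc c (D x))"

text \<open>
  The image of \<open>Der\<^sub>K A\<close> in \<open>Der\<^sub>K R\<close>: the derivations of \<open>R\<close> that extend some derivation of \<open>A\<close>.
\<close>

definition extended_derivations ::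
  "('k \<Rightarrow> 'a::idom \<Rightarrow> 'a) \<Rightarrow> ('a fract \<Rightarrow> 'a fract) set" where
  "extended_derivations sc = {D \<in> derivations UNIV (fract_scale sc) UNIV.
     \<exists>d \<in> derivations UNIV sc UNIV. \<forall>a. D (to_fract a) = to_fract (d a)}"

definition W :: "('k \<Rightarrow> 'a::idom \<Rightarrow> 'a) \<Rightarrow> ('a fract \<Rightarrow> 'a fract) set" where
  "W sc = fract_op.span (extended_derivations sc)"

section \<open>Subalgebras of W(A)\<close>

definition lie_subalgebra ::
  "('k::field_char_0 \<Rightarrow> 'a::idom \<Rightarrow> 'a) \<Rightarrow> ('a fract \<Rightarrow> 'a fract) set \<Rightarrow>
   ('a fract \<Rightarrow> 'a fract) set \<Rightarrow> bool" where
  "lie_subalgebra sc M L \<longleftrightarrow> L \<subseteq> M \<and> module.subspace (ground_scale sc) L \<and>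
     (\<forall>D\<in>L. \<forall>E\<in>L. lie_bracket D E \<in> L)"

primrec lower_central_series ::
  "('k::field_char_0 \<Rightarrow> 'a::idom \<Rightarrow> 'a) \<Rightarrow> ('a fract \<Rightarrow> 'a fract) set \<Rightarrow> nat \<Rightarrow>
   ('a fract \<Rightarrow> 'a fract) set" where
  "lower_central_series sc L 0 = L"
| "lower_central_series sc L (Suc i) =
     module.span (ground_scale sc) {lie_bracket D E |D E. D \<in> L \<and> E \<in> lower_central_series sc L i}"

definition nilpotent ::
  "('k::field_char_0 \<Rightarrow> 'a::idom \<Rightarrow> 'a) \<Rightarrow> ('a fract \<Rightarrow> 'a fract) set \<Rightarrow> bool" where
  "nilpotent sc L \<longleftrightarrow> (\<exists>i. lower_central_series sc L i = {0})"

definition center :: "('b \<Rightarrow> 'b::ab_group_add) set \<Rightarrow> ('b \<Rightarrow> 'b) set" where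
  "center L = {D \<in> L. \<forall>E\<in>L. lie_bracket D E = 0}"

text \<open>
  Since \<^const>\<open>fract_op.dim\<close> is 0 on spaces of infinite dimension, \<open>rk\<close> is meaningful only
  together with \<open>finite_rank\<close>.
\<close>

definition rk :: "('a::idom fract \<Rightarrow> 'a fract) set \<Rightarrow> nat" where
  "rk L = fract_op.dim (fract_op.span L)"

definition finite_rank :: "('a::idom fract \<Rightarrow> 'a fract) set \<Rightarrow> bool" where
  "finite_rank L \<longleftrightarrow> (\<exists>B. finite B \<and> fract_op.span B = fract_op.span L)"

definition constants :: "('b \<Rightarrow> 'b::zero) set \<Rightarrow> 'b set" where
  "constants L = {r. \<forall>D\<in>L. D r = 0}"

text \<open>
  The field of constants is a subset of the type \<^typ>\<open>'a fract\<close>, not a type, so the span over it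
  is not an instance of the library's span.
\<close>

definition span_over :: "'b set \<Rightarrow> ('b \<Rightarrow> 'b) set \<Rightarrow> ('b \<Rightarrow> 'b::comm_ring_1) set" where
  "span_over F L =
     {(\<Sum>D\<in>T. pointwise_mult (c D) D) |T c. finite T \<and> T \<subseteq> L \<and> (\<forall>D\<in>T. c D \<in> F)}"

section \<open>The triangular Lie algebra\<close>

text \<open>
  A polynomial in variables indexed by the naturals maps each monomial, given by its exponents,
  to its coefficient.
\<close>

type_synonym 'f mpoly = "(nat \<Rightarrow>\<^sub>0 nat) \<Rightarrow>\<^sub>0 'f"

definition polynomials :: "'f::field set \<Rightarrow> nat set \<Rightarrow> 'f mpoly set" where
  "polynomials F V = {p. \<forall>m\<in>Poly_Mapping.keys p.
     Poly_Mapping.lookup p m \<in> F \<and> Poly_Mapping.keys m \<subseteq> V}"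

definition poly_scale :: "'f::field \<Rightarrow> 'f mpoly \<Rightarrow> 'f mpoly" where
  "poly_scale c p = Poly_Mapping.single 0 c * p"

text \<open>
  When variable \<open>i\<close> does not occur in \<open>m\<close>, the truncated subtraction does no harm, because the
  coefficient is then 0.
\<close>

definition partial_deriv :: "nat \<Rightarrow> 'f::field mpoly \<Rightarrow> 'f mpoly" where
  "partial_deriv i p = (\<Sum>m\<in>Poly_Mapping.keys p.
     Poly_Mapping.single (m - Poly_Mapping.single i 1)
       (of_nat (Poly_Mapping.lookup m i) * Poly_Mapping.lookup p m))"

definition triangular :: "nat \<Rightarrow> 'f::field set \<Rightarrow> ('f mpoly \<Rightarrow> 'f mpoly) set" where
  "triangular n F = {D \<in> derivations F poly_scale (polynomials F {1..n}).
     \<exists>f. (\<forall>i\<in>{1..n}. f i \<in> polynomials F {i<..n}) \<and>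
         (\<forall>p\<in>polynomials F {1..n}. D p = (\<Sum>i=1..n. f i * partial_deriv i p))}"

definition op_scale :: "'f::field \<Rightarrow> ('f mpoly \<Rightarrow> 'f mpoly) \<Rightarrow> 'f mpoly \<Rightarrow> 'f mpoly" where
  "op_scale c D = (\<lambda>p. poly_scale c (D p))"

definition lie_embedding ::
  "'f::field set \<Rightarrow> ('f \<Rightarrow> 'f) set \<Rightarrow> ('f mpoly \<Rightarrow> 'f mpoly) set \<Rightarrow>
   (('f \<Rightarrow> 'f) \<Rightarrow> 'f mpoly \<Rightarrow> 'f mpoly) \<Rightarrow> bool" where
  "lie_embedding F L M \<phi> \<longleftrightarrow>
     (\<forall>D\<in>L. \<phi> D \<in> M) \<and> inj_on \<phi> L \<and>
     (\<forall>D\<in>L. \<forall>E\<in>L. \<phi> (D + E) = \<phi> D + \<phi> E) \<and>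
     (\<forall>c\<in>F. \<forall>D\<in>L. \<phi> (pointwise_mult c D) = op_scale c (\<phi> D)) \<and>
     (\<forall>D\<in>L. \<forall>E\<in>L. \<phi> (lie_bracket D E) = lie_bracket (\<phi> D) (\<phi> E))"

end

theory Submission
  imports Defs
begin

text \<open>
  Let \<open>n \<ge> 2\<close> and \<open>k = n - 2\<close>.  Choose \<open>B\<^sub>1, \<dots>, B\<^sub>k\<close> in the center of \<open>L\<close>, linearly independent over \<open>R\<close>.  Since
  \<open>L\<close> is nilpotent, there is an \<open>X \<in> L\<close> outside the \<open>R\<close>-span of the \<open>B\<^sub>i\<close> that is central modulo this
  span, and then a \<open>Y \<in> L\<close> outside the \<open>R\<close>-span of \<open>X\<close> and the \<open>B\<^sub>i\<close> that is central modulo that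
  one (\<open>central_modulo\<close>).  These \<open>n\<close> derivations are a basis of \<open>R L\<close>, the \<open>B\<^sub>i\<close> commute with
  everything, and \<open>[Y, X] = \<Sum> g\<^sub>i B\<^sub>i\<close> for some \<open>g\<^sub>i \<in> R\<close>.

  Write an element of \<open>L\<close> as \<open>c Y + s X + \<Sum> r\<^sub>i B\<^sub>i\<close>.  Comparing coefficients in its brackets with
  \<open>B\<^sub>i\<close>, \<open>X\<close> and \<open>Y\<close> shows that \<open>c\<close> is a constant of \<open>L\<close>, that all coefficients lie in the field
  \<open>R\<^sub>0\<close> of common constants of the \<open>B\<^sub>i\<close>, and that \<open>X s = 0\<close> (\<open>coefficients\<close>).  On \<open>R\<^sub>0\<close> the derivations
  \<open>X\<close> and \<open>Y\<close> commute, because their bracket is a combination of the \<open>B\<^sub>i\<close>, and their common kernel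
  there is \<open>F\<close>.  Nilpotency of \<open>L\<close> forces \<open>s\<close> and the \<open>r\<^sub>i\<close> into the algebra \<open>T \<subseteq> R\<^sub>0\<close> of elements
  killed by all sufficiently long products of \<open>X\<close> and \<open>Y\<close> (\<open>coefficients_in_T\<close>).

  On \<open>T\<close> the Taylor expansion \<open>\<tau>(r) = \<Sum> \<epsilon>(X\<^sup>i Y\<^sup>j r) x\<^sup>i y\<^sup>j / (i! j!)\<close>, where \<open>\<epsilon>\<close> is an \<open>F\<close>-linear
  functional with \<open>\<epsilon>(1) = 1\<close>, is an injective map to \<open>F[x, y]\<close> that turns \<open>X\<close> and \<open>Y\<close> into the
  partial derivatives.  The functional can be chosen such that moreover \<open>\<tau>(s t) = \<tau>(s) \<tau>(t)\<close>
  whenever \<open>X s = 0\<close> (\<open>multiplicative_functional_exists\<close>, \<open>taylor_mult\<close>).  These are the only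
  products that occur in a bracket, as the \<open>B\<^sub>i\<close> kill all coefficients.  With variables
  \<open>x\<^sub>1, \<dots>, x\<^sub>k, x, y\<close>, the embedding sends
  \<open>c Y + s X + \<Sum> r\<^sub>i B\<^sub>i\<close> to \<open>c \<partial>\<^sub>y + \<tau>(s) \<partial>\<^sub>x + \<Sum> (\<tau>(r\<^sub>i) + c h\<^sub>i) \<partial>\<^sub>i\<close>.
  Here \<open>\<partial>\<^sub>x h\<^sub>i = - \<tau>(g\<^sub>i)\<close>, which makes the image of \<open>Y\<close> have the right bracket with the image of \<open>X\<close>
  (\<open>envelope_embedding\<close>).  This map is defined on all combinations with \<open>c \<in> F\<close>, \<open>s \<in> T\<close>, \<open>X s = 0\<close>
  and \<open>r\<^sub>i \<in> T\<close>, hence on \<open>F L\<close>.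

  When \<open>n \<le> 1\<close>, the algebra \<open>F L\<close> is zero or \<open>F D\<close> for a single derivation \<open>D\<close>.
\<close>

section \<open>Subfields\<close>

text \<open>
  The field of constants depends on \<open>L\<close>, so it is a set and not a type.
\<close>

locale subfield_set =
  fixes F :: "'r::field set"
  assumes zero_mem: "0 \<in> F" and one_mem: "1 \<in> F"
    and add_mem: "a \<in> F \<Longrightarrow> b \<in> F \<Longrightarrow> a + b \<in> F"
    and uminus_mem: "a \<in> F \<Longrightarrow> - a \<in> F"
    and mult_mem: "a \<in> F \<Longrightarrow> b \<in> F \<Longrightarrow> a * b \<in> F"
    and inverse_mem: "a \<in> F \<Longrightarrow> inverse a \<in> F"
begin

lemma diff_mem: "a \<in> F \<Longrightarrow> b \<in> F \<Longrightarrow> a - b \<in> F"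
  using add_mem[of a "- b"] uminus_mem by simp

lemma divide_mem: "a \<in> F \<Longrightarrow> b \<in> F \<Longrightarrow> a / b \<in> F"
  by (simp add: divide_inverse mult_mem inverse_mem)

lemma of_nat_mem: "of_nat k \<in> F"
  by (induction k) (auto intro: zero_mem one_mem add_mem)

end

section \<open>Polynomials and their partial derivatives\<close>

lemma sum_of_monomials:
  "(\<Sum>m\<in>Poly_Mapping.keys p. Poly_Mapping.single m (Poly_Mapping.lookup p m)) = p"
  by (rule poly_mapping_eqI)
     (auto simp: lookup_sum lookup_single when_def not_in_keys_iff_lookup_eq_zero)

text \<open>
  Differentiation as an operation on coefficients.  No truncated subtraction is left, so identities
  such as the symmetry of second derivatives can be checked coefficient by coefficient.
\<close>

lemma lookup_partial_deriv:
  "Poly_Mapping.lookup (partial_deriv i p) m =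
     of_nat (Suc (Poly_Mapping.lookup m i)) * Poly_Mapping.lookup p (m + Poly_Mapping.single i 1)"
proof -
  let ?e = "Poly_Mapping.single i (1::nat)"
  have pos: "m' = m + ?e" if "m' - ?e = m" and "Poly_Mapping.lookup m' i \<noteq> 0" for m'
  proof (rule poly_mapping_eqI)
    fix k
    show "Poly_Mapping.lookup m' k = Poly_Mapping.lookup (m + ?e) k"
      using that by (auto simp: lookup_add lookup_minus lookup_single when_def)
  qed
  have "Poly_Mapping.lookup (partial_deriv i p) m =
    (\<Sum>m'\<in>Poly_Mapping.keys p.
       (of_nat (Poly_Mapping.lookup m' i) * Poly_Mapping.lookup p m' when m' - ?e = m))"
    by (simp add: partial_deriv_def lookup_sum lookup_single)
  also have "\<dots> = (\<Sum>m'\<in>Poly_Mapping.keys p.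
       if m' = m + ?e then of_nat (Suc (Poly_Mapping.lookup m i)) * Poly_Mapping.lookup p m' else 0)"
  proof (rule sum.cong[OF refl])
    fix m'
    show "(of_nat (Poly_Mapping.lookup m' i) * Poly_Mapping.lookup p m' when m' - ?e = m) =
      (if m' = m + ?e then of_nat (Suc (Poly_Mapping.lookup m i)) * Poly_Mapping.lookup p m' else 0)"
    proof (cases "m' = m + ?e")
      case True
      then show ?thesis by (simp add: lookup_add)
    next
      case False
      then show ?thesis
        using pos[of m'] by (cases "Poly_Mapping.lookup m' i = 0") (auto simp: when_def)
    qed
  qed
  also have "\<dots> = of_nat (Suc (Poly_Mapping.lookup m i)) * Poly_Mapping.lookup p (m + ?e)"
    by (auto simp: not_in_keys_iff_lookup_eq_zero)
  finally show ?thesis .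
qed

lemma partial_deriv_add: "partial_deriv i (p + q) = partial_deriv i p + partial_deriv i q"
  by (rule poly_mapping_eqI) (simp add: lookup_partial_deriv lookup_add distrib_left)

lemma partial_deriv_zero: "partial_deriv i 0 = 0"
  by (simp add: partial_deriv_def)

lemma partial_deriv_sum: "partial_deriv i (sum f S) = (\<Sum>x\<in>S. partial_deriv i (f x))"
  by (induction S rule: infinite_finite_induct) (auto simp: partial_deriv_add partial_deriv_zero)

lemma partial_deriv_single:
  "partial_deriv i (Poly_Mapping.single m c) =
     Poly_Mapping.single (m - Poly_Mapping.single i 1) (of_nat (Poly_Mapping.lookup m i) * c)"
  by (cases "c = 0") (simp_all add: partial_deriv_def)

lemma partial_deriv_const: "partial_deriv i (Poly_Mapping.single 0 c) = 0"
  by (simp add: partial_deriv_single)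

lemma partial_deriv_commute:
  "partial_deriv i (partial_deriv j p) = partial_deriv j (partial_deriv i p)"
  by (cases "i = j")
     (auto intro!: poly_mapping_eqI simp: lookup_partial_deriv lookup_add lookup_single ac_simps)

text \<open>
  The Leibniz rule follows from the case of monomials by bilinearity.  The truncated subtraction in the
  exponent is harmless: when the variable is absent, the coefficient vanishes.
\<close>

lemma partial_deriv_single_mult:
  "partial_deriv i (Poly_Mapping.single m c * Poly_Mapping.single m' c') =
     partial_deriv i (Poly_Mapping.single m c) * Poly_Mapping.single m' c' +
     Poly_Mapping.single m c * partial_deriv i (Poly_Mapping.single m' (c'::'f::field))"
proof -
  let ?e = "Poly_Mapping.single i (1::nat)"
  have shift: "m1 - ?e + m2 = m1 + m2 - ?e" if "Poly_Mapping.lookup m1 i \<noteq> 0" for m1 m2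
    using that by (intro poly_mapping_eqI) (auto simp: lookup_add lookup_minus lookup_single when_def)
  have "partial_deriv i (Poly_Mapping.single m c) * Poly_Mapping.single m' c' =
      Poly_Mapping.single (m + m' - ?e) (of_nat (Poly_Mapping.lookup m i) * c * c')"
    using shift[of m m']
    by (cases "Poly_Mapping.lookup m i = 0") (auto simp: partial_deriv_single mult_single)
  moreover have "Poly_Mapping.single m c * partial_deriv i (Poly_Mapping.single m' c') =
      Poly_Mapping.single (m + m' - ?e) (of_nat (Poly_Mapping.lookup m' i) * c * c')"
    using shift[of m' m]
    by (cases "Poly_Mapping.lookup m' i = 0")
       (auto simp: partial_deriv_single mult_single ac_simps)
  ultimately show ?thesis
    by (simp add: mult_single partial_deriv_single lookup_add flip: single_add)
       (simp add: algebra_simps)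
qed

lemma partial_deriv_mult:
  "partial_deriv i (p * q) = partial_deriv i p * q + p * partial_deriv i (q :: 'f::field mpoly)"
proof -
  let ?s = "\<lambda>p m. Poly_Mapping.single m (Poly_Mapping.lookup (p :: 'f mpoly) m)"
  have "partial_deriv i ((\<Sum>m\<in>Poly_Mapping.keys p. ?s p m) * (\<Sum>m\<in>Poly_Mapping.keys q. ?s q m)) =
      partial_deriv i (\<Sum>m\<in>Poly_Mapping.keys p. ?s p m) * (\<Sum>m\<in>Poly_Mapping.keys q. ?s q m) +
      (\<Sum>m\<in>Poly_Mapping.keys p. ?s p m) * partial_deriv i (\<Sum>m\<in>Poly_Mapping.keys q. ?s q m)"
    by (simp add: sum_product partial_deriv_sum partial_deriv_single_mult sum.distrib)
  then show ?thesis by (simp add: sum_of_monomials)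
qed

context subfield_set
begin

lemma polynomials_iff:
  "p \<in> polynomials F V \<longleftrightarrow> (\<forall>m. Poly_Mapping.lookup p m \<in> F \<and>
     (Poly_Mapping.lookup p m \<noteq> 0 \<longrightarrow> Poly_Mapping.keys m \<subseteq> V))"
  unfolding polynomials_def mem_Collect_eq Ball_def in_keys_iff using zero_mem by metis

lemma polynomials_zero: "0 \<in> polynomials F V"
  by (simp add: polynomials_def)

lemma polynomials_add: "p \<in> polynomials F V \<Longrightarrow> q \<in> polynomials F V \<Longrightarrow> p + q \<in> polynomials F V"
  by (auto simp: polynomials_iff lookup_add intro: add_mem) (metis add.right_neutral subsetD)

lemma polynomials_uminus: "p \<in> polynomials F V \<Longrightarrow> - p \<in> polynomials F V"
  by (auto simp: polynomials_iff intro: uminus_mem)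

lemma polynomials_sum: "(\<And>x. x \<in> S \<Longrightarrow> f x \<in> polynomials F V) \<Longrightarrow> sum f S \<in> polynomials F V"
  by (induction S rule: infinite_finite_induct) (auto intro: polynomials_zero polynomials_add)

lemma polynomials_single:
  "c \<in> F \<Longrightarrow> Poly_Mapping.keys m \<subseteq> V \<Longrightarrow> Poly_Mapping.single m c \<in> polynomials F V"
  by (auto simp: polynomials_def)

lemma polynomials_const: "c \<in> F \<Longrightarrow> Poly_Mapping.single 0 c \<in> polynomials F V"
  by (simp add: polynomials_single)

lemma polynomials_mult:
  assumes "p \<in> polynomials F V" and "q \<in> polynomials F V"
  shows "p * q \<in> polynomials F V"
proof -
  have "p * q = (\<Sum>m\<in>Poly_Mapping.keys p. \<Sum>m'\<in>Poly_Mapping.keys q.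
     Poly_Mapping.single (m + m') (Poly_Mapping.lookup p m * Poly_Mapping.lookup q m'))"
    by (subst (1) sum_of_monomials[symmetric], subst (3) sum_of_monomials[symmetric])
       (simp add: sum_product mult_single)
  also have "\<dots> \<in> polynomials F V"
    using assms
    by (intro polynomials_sum polynomials_single mult_mem)
       (auto simp: polynomials_def dest!: subsetD[OF keys_add])
  finally show ?thesis .
qed

lemma polynomials_partial_deriv:
  "p \<in> polynomials F V \<Longrightarrow> partial_deriv i p \<in> polynomials F V"
  unfolding polynomials_iff lookup_partial_deriv
  by (auto intro!: mult_mem of_nat_mem simp del: of_nat_Suc)
     (metis (no_types, lifting) add_eq_0_iff_both_eq_0 in_keys_iff lookup_add subsetD)

lemma polynomials_mono: "p \<in> polynomials F V \<Longrightarrow> V \<subseteq> V' \<Longrightarrow> p \<in> polynomials F V'"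
  by (auto simp: polynomials_def)

lemma partial_deriv_absent:
  assumes "p \<in> polynomials F V" "i \<notin> V"
  shows "partial_deriv i p = 0"
proof (rule poly_mapping_eqI)
  fix m :: "nat \<Rightarrow>\<^sub>0 nat"
  have "i \<in> Poly_Mapping.keys (m + Poly_Mapping.single i 1)"
    by (simp add: in_keys_iff lookup_add)
  then have "Poly_Mapping.lookup p (m + Poly_Mapping.single i 1) = 0"
    using assms by (auto simp: polynomials_iff)
  then show "Poly_Mapping.lookup (partial_deriv i p) m = Poly_Mapping.lookup 0 m"
    by (simp add: lookup_partial_deriv)
qed

text \<open>
  Integrating a monomial divides its coefficient by the new exponent, hence the condition on the
  characteristic.
\<close>

lemma polynomial_antiderivative:
  assumes char0: "\<And>k. of_nat (Suc k) \<noteq> (0::'r)"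
    and p: "p \<in> polynomials F V" and i: "i \<in> V"
  obtains q where "q \<in> polynomials F V" "partial_deriv i q = p"
proof
  let ?q = "\<Sum>m\<in>Poly_Mapping.keys p. Poly_Mapping.single (m + Poly_Mapping.single i 1)
              (Poly_Mapping.lookup p m / of_nat (Suc (Poly_Mapping.lookup m i)))"
  show "?q \<in> polynomials F V"
    using p i by (intro polynomials_sum polynomials_single divide_mem of_nat_mem)
      (auto simp: polynomials_def dest!: subsetD[OF keys_add])
  have "partial_deriv i ?q =
      (\<Sum>m\<in>Poly_Mapping.keys p. Poly_Mapping.single m (Poly_Mapping.lookup p m))"
    unfolding partial_deriv_sum partial_deriv_single
  proof (rule sum.cong[OF refl])
    fix m
    show "Poly_Mapping.single (m + Poly_Mapping.single i 1 - Poly_Mapping.single i 1)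
        (of_nat (Poly_Mapping.lookup (m + Poly_Mapping.single i 1) i) *
         (Poly_Mapping.lookup p m / of_nat (Suc (Poly_Mapping.lookup m i)))) =
      Poly_Mapping.single m (Poly_Mapping.lookup p m)"
    proof -
      have "Poly_Mapping.lookup (m + Poly_Mapping.single i 1) i = Suc (Poly_Mapping.lookup m i)"
        by (simp add: lookup_add)
      then show ?thesis
        using char0[of "Poly_Mapping.lookup m i"] by (simp del: of_nat_Suc)
    qed
  qed
  then show "partial_deriv i ?q = p" by (simp add: sum_of_monomials)
qed

end

lemma keys_add_single: 
  "Poly_Mapping.keys (m + Poly_Mapping.single i (1::nat)) = insert i (Poly_Mapping.keys m)"
  by (auto simp: in_keys_iff lookup_add lookup_single when_def split: if_splits)

lemma monomial_add_eq_zero: "m + m' = 0 \<longleftrightarrow> m = 0 \<and> m' = (0 :: nat \<Rightarrow>\<^sub>0 nat)"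
  by (auto simp: poly_mapping_eq_iff fun_eq_iff lookup_add)

lemma lookup_mult_zero:
  "Poly_Mapping.lookup (p * q) 0 = Poly_Mapping.lookup p 0 * Poly_Mapping.lookup (q :: 'f::field mpoly) 0"
proof -
  let ?s = "\<lambda>p m. Poly_Mapping.single m (Poly_Mapping.lookup (p :: 'f mpoly) m)"
  have "Poly_Mapping.lookup ((\<Sum>m\<in>Poly_Mapping.keys p. ?s p m) * (\<Sum>m\<in>Poly_Mapping.keys q. ?s q m)) 0 =
     (\<Sum>m\<in>Poly_Mapping.keys p. \<Sum>m'\<in>Poly_Mapping.keys q.
        if m = 0 then if m' = 0 then Poly_Mapping.lookup p m * Poly_Mapping.lookup q m' else 0 else 0)"
    unfolding sum_product lookup_sum mult_single lookup_single
    by (intro sum.cong refl) (auto simp: when_def monomial_add_eq_zero)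
  also have "\<dots> = (\<Sum>m\<in>Poly_Mapping.keys p. if m = 0 then
        (\<Sum>m'\<in>Poly_Mapping.keys q. if m' = 0 then Poly_Mapping.lookup p m * Poly_Mapping.lookup q m' else 0) else 0)"
    by (intro sum.cong refl) auto
  also have "\<dots> = Poly_Mapping.lookup p 0 * Poly_Mapping.lookup q 0"
    by (auto simp: not_in_keys_iff_lookup_eq_zero)
  finally show ?thesis by (simp add: sum_of_monomials)
qed

text \<open>
  In characteristic zero a nonconstant monomial is recovered from its derivative with respect to any
  variable that occurs in it.
\<close>

lemma (in subfield_set) polynomial_eqI:
  assumes char0: "\<And>k. of_nat (Suc k) \<noteq> (0::'r)"
    and p: "p \<in> polynomials F V" and q: "q \<in> polynomials F V"
    and deriv: "\<And>i. i \<in> V \<Longrightarrow> partial_deriv i p = partial_deriv i q"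
    and const: "Poly_Mapping.lookup p 0 = Poly_Mapping.lookup q 0"
  shows "p = q"
proof (rule poly_mapping_eqI)
  fix m :: "nat \<Rightarrow>\<^sub>0 nat"
  consider "m = 0" | i where "i \<in> Poly_Mapping.keys m" "i \<notin> V"
    | i where "i \<in> Poly_Mapping.keys m" "i \<in> V"
    by (metis all_not_in_conv keys_eq_empty)
  then show "Poly_Mapping.lookup p m = Poly_Mapping.lookup q m"
  proof cases
    case 2
    then have "Poly_Mapping.lookup p m = 0" "Poly_Mapping.lookup q m = 0"
      using p q unfolding polynomials_iff by blast+
    then show ?thesis by simp
  next
    case 3
    define m' where "m' = m - Poly_Mapping.single i 1"
    have m: "m = m' + Poly_Mapping.single i 1"
      using 3 by (intro poly_mapping_eqI)
        (auto simp: m'_def lookup_add lookup_minus lookup_single when_def in_keys_iff)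
    show ?thesis
      using arg_cong[OF deriv[OF 3(2)], of "\<lambda>p. Poly_Mapping.lookup p m'"] char0[of "Poly_Mapping.lookup m' i"]
      by (simp add: lookup_partial_deriv m del: of_nat_Suc)
  qed (use const in simp)
qed

section \<open>Triangular vector fields\<close>

definition vector_field :: "nat \<Rightarrow> (nat \<Rightarrow> 'f::field mpoly) \<Rightarrow> 'f mpoly \<Rightarrow> 'f mpoly" where
  "vector_field n f p = (\<Sum>i=1..n. f i * partial_deriv i p)"

text \<open>
  In the commutator of two first-order operators the second-order terms cancel, because partial
  derivatives commute.
\<close>

lemma vector_field_bracket:
  "vector_field n f (vector_field n g p) - vector_field n g (vector_field n f p) =
   vector_field n (\<lambda>i. vector_field n f (g i) - vector_field n g (f i)) p"
proof -
  have "vector_field n f (vector_field n g p) =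
     vector_field n (\<lambda>i. vector_field n f (g i)) p +
     (\<Sum>i=1..n. \<Sum>j=1..n. f i * g j * partial_deriv i (partial_deriv j p))" for f g
    unfolding vector_field_def
    by (simp add: partial_deriv_sum partial_deriv_mult distrib_left sum.distrib
         sum_distrib_left sum_distrib_right mult.assoc) (rule sum.swap)
  moreover have "(\<Sum>i=1..n. \<Sum>j=1..n. g i * f j * partial_deriv i (partial_deriv j p)) =
     (\<Sum>i=1..n. \<Sum>j=1..n. f i * g j * partial_deriv i (partial_deriv j p))"
    by (subst sum.swap) (simp add: partial_deriv_commute mult.commute[of "g _"])
  ultimately show ?thesis
    by (simp add: vector_field_def left_diff_distrib sum_subtractf)
qed

context subfield_set
begin

lemma vector_field_in_triangular:
  assumes f: "\<And>i. i \<in> {1..n} \<Longrightarrow> f i \<in> polynomials F {i<..n}"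
  shows "(\<lambda>p. if p \<in> polynomials F {1..n} then vector_field n f p else 0) \<in> triangular n F"
proof -
  have f': "f i \<in> polynomials F {1..n}" if "i \<in> {1..n}" for i
    using f[OF that] by (rule polynomials_mono) auto
  have scale: "poly_scale c p \<in> polynomials F V" if "c \<in> F" "p \<in> polynomials F V" for c p V
    unfolding poly_scale_def using that by (intro polynomials_mult polynomials_const)
  show ?thesis
    unfolding triangular_def derivations_def
    by (auto simp: polynomials_add polynomials_mult polynomials_zero scale polynomials_const
           vector_field_def poly_scale_def partial_deriv_add partial_deriv_mult partial_deriv_const
           sum.distrib sum_distrib_left sum_distrib_right algebra_simps
           simp del: One_nat_def atLeastAtMost_iff
           intro!: polynomials_sum polynomials_mult f' polynomials_partial_deriv polynomials_const exI[of _ f] f)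
qed

text \<open>
  An embedding into \<open>u\<^sub>n\<close> amounts to a choice of coefficient polynomials \<open>\<kappa> D i\<close> that is linear and
  injective and satisfies the bracket formula of vector fields.  Injectivity passes to operators
  because a vector field is determined by its values on the variables.
\<close>

lemma lie_embedding_by_coordinates:
  fixes \<kappa> :: "('r \<Rightarrow> 'r) \<Rightarrow> nat \<Rightarrow> 'r mpoly"
  assumes mem: "\<And>D i. D \<in> G \<Longrightarrow> i \<in> {1..n} \<Longrightarrow> \<kappa> D i \<in> polynomials F {i<..n}"
    and inj: "\<And>D E. D \<in> G \<Longrightarrow> E \<in> G \<Longrightarrow> (\<And>i. i \<in> {1..n} \<Longrightarrow> \<kappa> D i = \<kappa> E i) \<Longrightarrow> D = E"
    and add: "\<And>D E i. D \<in> G \<Longrightarrow> E \<in> G \<Longrightarrow> i \<in> {1..n} \<Longrightarrow> \<kappa> (D + E) i = \<kappa> D i + \<kappa> E i"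
    and scale: "\<And>c D i. c \<in> F \<Longrightarrow> D \<in> G \<Longrightarrow> i \<in> {1..n} \<Longrightarrow>
                  \<kappa> (pointwise_mult c D) i = poly_scale c (\<kappa> D i)"
    and bracket: "\<And>D E i. D \<in> G \<Longrightarrow> E \<in> G \<Longrightarrow> i \<in> {1..n} \<Longrightarrow> \<kappa> (lie_bracket D E) i =
                  vector_field n (\<kappa> D) (\<kappa> E i) - vector_field n (\<kappa> E) (\<kappa> D i)"
  shows "lie_embedding F G (triangular n F)
           (\<lambda>D p. if p \<in> polynomials F {1..n} then vector_field n (\<kappa> D) p else 0)"
proof -
  let ?P = "polynomials F {1..n}"
  have mem': "\<kappa> D i \<in> ?P" if "D \<in> G" "i \<in> {1..n}" for D i
    using mem[OF that] by (rule polynomials_mono) auto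
  have closed: "vector_field n (\<kappa> D) p \<in> ?P" if "D \<in> G" "p \<in> ?P" for D p
    unfolding vector_field_def using that
    by (intro polynomials_sum polynomials_mult polynomials_partial_deriv mem')
  have var: "vector_field n f (Poly_Mapping.single (Poly_Mapping.single i 1) 1) = f i"
    if "i \<in> {1..n}" for f :: "nat \<Rightarrow> 'r mpoly" and i
  proof -
    have "partial_deriv j (Poly_Mapping.single (Poly_Mapping.single i 1) 1 :: 'r mpoly) =
        (if j = i then 1 else 0)" for j
      by (auto simp: partial_deriv_single lookup_single when_def)
    then have "vector_field n f (Poly_Mapping.single (Poly_Mapping.single i 1) 1) =
        (\<Sum>j=1..n. if j = i then f j else 0)"
      unfolding vector_field_def by (intro sum.cong) auto
    then show ?thesis using that by simp
  qed
  have var_mem: "Poly_Mapping.single (Poly_Mapping.single i 1) 1 \<in> ?P" if "i \<in> {1..n}" for i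
    using that by (intro polynomials_single one_mem) auto
  have injective: "D = E" if DE: "D \<in> G" "E \<in> G"
    and eq: "(\<lambda>p. if p \<in> ?P then vector_field n (\<kappa> D) p else 0) =
             (\<lambda>p. if p \<in> ?P then vector_field n (\<kappa> E) p else 0)" for D E
  proof (rule inj[OF DE])
    fix i assume i: "i \<in> {1..n}"
    show "\<kappa> D i = \<kappa> E i"
      using fun_cong[OF eq, of "Poly_Mapping.single (Poly_Mapping.single i 1) 1"]
      by (simp only: var[OF i] var_mem[OF i] if_True)
  qed
  have br: "vector_field n (\<kappa> (lie_bracket D E)) p =
      vector_field n (\<kappa> D) (vector_field n (\<kappa> E) p) - vector_field n (\<kappa> E) (vector_field n (\<kappa> D) p)"
    if "D \<in> G" "E \<in> G" for D E p
    unfolding vector_field_bracket using bracket[OF that] by (simp add: vector_field_def[of n _ p])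
  show ?thesis
    unfolding lie_embedding_def inj_on_def
  proof (intro conjI ballI impI)
    fix D assume "D \<in> G"
    then show "(\<lambda>p. if p \<in> ?P then vector_field n (\<kappa> D) p else 0) \<in> triangular n F"
      by (intro vector_field_in_triangular mem)
  next
    fix D E assume DE: "D \<in> G" "E \<in> G"
    then show "(\<lambda>p. if p \<in> ?P then vector_field n (\<kappa> (D + E)) p else 0) =
       (\<lambda>p. if p \<in> ?P then vector_field n (\<kappa> D) p else 0) +
       (\<lambda>p. if p \<in> ?P then vector_field n (\<kappa> E) p else 0)"
      by (auto simp: fun_eq_iff vector_field_def add distrib_right sum.distrib)
    show "(\<lambda>p. if p \<in> ?P then vector_field n (\<kappa> (lie_bracket D E)) p else 0) =
       lie_bracket (\<lambda>p. if p \<in> ?P then vector_field n (\<kappa> D) p else 0)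
                   (\<lambda>p. if p \<in> ?P then vector_field n (\<kappa> E) p else 0)"
    proof
      fix p
      show "(if p \<in> ?P then vector_field n (\<kappa> (lie_bracket D E)) p else 0) =
         lie_bracket (\<lambda>p. if p \<in> ?P then vector_field n (\<kappa> D) p else 0)
                     (\<lambda>p. if p \<in> ?P then vector_field n (\<kappa> E) p else 0) p"
        unfolding br[OF DE] using closed[OF DE(1)] closed[OF DE(2)]
        by (cases "p \<in> ?P", simp_all add: lie_bracket_def)
           (simp add: vector_field_def partial_deriv_zero)
    qed
  next
    fix c D assume "c \<in> F" "D \<in> G"
    then show "(\<lambda>p. if p \<in> ?P then vector_field n (\<kappa> (pointwise_mult c D)) p else 0) =
       op_scale c (\<lambda>p. if p \<in> ?P then vector_field n (\<kappa> D) p else 0)"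
      by (auto simp: fun_eq_iff op_scale_def vector_field_def scale poly_scale_def
            sum_distrib_left mult.assoc)
  qed (use injective in blast)
qed

end

section \<open>Derivations of a field\<close>

definition derivation :: "('r::field \<Rightarrow> 'r) \<Rightarrow> bool" where
  "derivation D \<longleftrightarrow> (\<forall>x y. D (x + y) = D x + D y) \<and> (\<forall>x y. D (x * y) = D x * y + x * D y)"

lemma derivation_add: "derivation D \<Longrightarrow> D (x + y) = D x + D y"
  and derivation_mult: "derivation D \<Longrightarrow> D (x * y) = D x * y + x * D y"
  by (auto simp: derivation_def)

lemma derivation_zero: "derivation D \<Longrightarrow> D 0 = 0"
  using derivation_add[of D 0 0] by (metis add_0_right add_left_imp_eq)

lemma derivation_one: "derivation D \<Longrightarrow> D 1 = 0"
  using derivation_mult[of D 1 1] by (metis add_0_right add_left_imp_eq mult_1 mult_1_right)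

lemma derivation_uminus: "derivation D \<Longrightarrow> D (- x) = - D x"
  using derivation_add[of D x "- x"] by (simp add: derivation_zero eq_neg_iff_add_eq_0 add.commute)

lemma derivation_diff: "derivation D \<Longrightarrow> D (x - y) = D x - D y"
  using derivation_add[of D x "- y"] by (simp add: derivation_uminus)

lemma derivation_sum: "derivation D \<Longrightarrow> D (sum f S) = (\<Sum>x\<in>S. D (f x))"
  by (induction S rule: infinite_finite_induct) (auto simp: derivation_zero derivation_add)

lemma derivation_inverse: 
  assumes "derivation D" shows "D (inverse x) = - D x * inverse x * inverse x"
proof (cases "x = 0")
  case False
  then have "D (inverse x) * x + inverse x * D x = 0"
    using derivation_mult[OF assms, of "inverse x" x] by (simp add: derivation_one[OF assms])
  then have "D (inverse x) * x = - (inverse x * D x)"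
    by (simp add: eq_neg_iff_add_eq_0)
  then have "D (inverse x) * x * inverse x = - (inverse x * D x) * inverse x"
    by simp
  then show ?thesis using False by (simp add: mult.assoc mult.commute[of "inverse x" "D x"])
qed (simp add: derivation_zero[OF assms])

lemma derivation_power:
  "derivation D \<Longrightarrow> D (x ^ Suc n) = of_nat (Suc n) * x ^ n * D x"
proof (induction n)
  case (Suc n)
  have "D (x ^ Suc (Suc n)) = D x * x ^ Suc n + x * D (x ^ Suc n)"
    using derivation_mult[OF Suc.prems, of x "x ^ Suc n"] by simp
  then show ?case using Suc by (simp add: algebra_simps)
qed simp

lemma subfield_set_derivation_kernel:
  assumes "subfield_set R\<^sub>0" and "derivation D"
  shows "subfield_set {r \<in> R\<^sub>0. D r = 0}"
proof -
  interpret subfield_set R\<^sub>0 by fact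
  show ?thesis
    using assms(2)
    by unfold_locales
       (auto simp: derivation_zero derivation_one derivation_add derivation_uminus derivation_mult
         derivation_inverse intro: zero_mem one_mem add_mem uminus_mem mult_mem inverse_mem)
qed

lemma subfield_set_constants:
  assumes "\<And>D. D \<in> S \<Longrightarrow> derivation D"
  shows "subfield_set (constants S)"
  using assms unfolding constants_def
  by unfold_locales
     (auto simp: derivation_zero derivation_one derivation_add derivation_uminus derivation_mult
       derivation_inverse)

section \<open>Linear functionals over a subfield\<close>

text \<open>
  By Zorn's lemma there is a maximal \<open>F\<close>-subspace \<open>H\<close> that contains \<open>H\<^sub>0\<close> but not \<open>1\<close>.  Maximality means
  that the whole field is the direct sum of \<open>H\<close> and \<open>F\<close>, and \<open>\<epsilon>\<close> is the projection to \<open>F\<close> along \<open>H\<close>.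
\<close>

lemma (in subfield_set) linear_functional_exists:
  assumes H\<^sub>0: "0 \<in> H\<^sub>0" "\<And>u v. u \<in> H\<^sub>0 \<Longrightarrow> v \<in> H\<^sub>0 \<Longrightarrow> u + v \<in> H\<^sub>0"
      "\<And>c u. c \<in> F \<Longrightarrow> u \<in> H\<^sub>0 \<Longrightarrow> c * u \<in> H\<^sub>0"
    and one: "1 \<notin> H\<^sub>0"
  obtains \<epsilon> where "\<And>r. \<epsilon> r \<in> F" "\<And>r s. \<epsilon> (r + s) = \<epsilon> r + \<epsilon> s"
    "\<And>c r. c \<in> F \<Longrightarrow> \<epsilon> (c * r) = c * \<epsilon> r" "\<epsilon> 1 = 1" "\<And>u. u \<in> H\<^sub>0 \<Longrightarrow> \<epsilon> u = 0"
proof -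
  define A where "A = {H. H\<^sub>0 \<subseteq> H \<and> 1 \<notin> H \<and> (\<forall>u\<in>H. \<forall>v\<in>H. u + v \<in> H) \<and> (\<forall>c\<in>F. \<forall>u\<in>H. c * u \<in> H)}"
  have "\<exists>M\<in>A. \<forall>H\<in>A. M \<subseteq> H \<longrightarrow> H = M"
  proof (rule subset_Zorn_nonempty)
    have "H\<^sub>0 \<in> A" unfolding A_def using assms by blast
    then show "A \<noteq> {}" by blast
  next
    fix \<C> assume ne: "\<C> \<noteq> {}" and chain: "subset.chain A \<C>"
    then have sub: "\<C> \<subseteq> A" and tot: "\<And>x y. x \<in> \<C> \<Longrightarrow> y \<in> \<C> \<Longrightarrow> x \<subseteq> y \<or> y \<subseteq> x"
      by (auto simp: subset.chain_def)
    show "\<Union>\<C> \<in> A"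
      unfolding A_def
    proof (intro CollectI conjI ballI)
      fix u v assume "u \<in> \<Union>\<C>" "v \<in> \<Union>\<C>"
      then obtain H where "H \<in> \<C>" "u \<in> H" "v \<in> H" using tot by blast
      then show "u + v \<in> \<Union>\<C>" using sub by (auto simp: A_def)
    next
      show "H\<^sub>0 \<subseteq> \<Union>\<C>" using sub ne unfolding A_def by blast
      show "1 \<notin> \<Union>\<C>" using sub unfolding A_def by blast
      show "c * u \<in> \<Union>\<C>" if "c \<in> F" "u \<in> \<Union>\<C>" for c u
        using sub that unfolding A_def by blast
    qed
  qed
  then obtain H where HA: "H \<in> A" and max: "\<And>H'. H' \<in> A \<Longrightarrow> H \<subseteq> H' \<Longrightarrow> H' = H" by blast
  have H: "H\<^sub>0 \<subseteq> H" "1 \<notin> H" "\<And>u v. u \<in> H \<Longrightarrow> v \<in> H \<Longrightarrow> u + v \<in> H"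
    "\<And>c u. c \<in> F \<Longrightarrow> u \<in> H \<Longrightarrow> c * u \<in> H" using HA unfolding A_def by blast+
  have H_diff: "u - v \<in> H" if "u \<in> H" "v \<in> H" for u v
    using H(3)[OF that(1) H(4)[OF uminus_mem[OF one_mem] that(2)]] by simp
  have unique: "c = d" if "c \<in> F" "d \<in> F" "r - c \<in> H" "r - d \<in> H" for r c d
  proof (rule ccontr)
    assume "c \<noteq> d"
    have "(r - d) - (r - c) \<in> H" using that H_diff by blast
    then have "inverse (c - d) * (c - d) \<in> H"
      using that by (intro H(4) inverse_mem diff_mem) auto
    then show False using \<open>c \<noteq> d\<close> H(2) by simp
  qed
  (* For r outside H, the space H + F r contains 1, so r is in F + H. *)
  have ex: "\<exists>c. c \<in> F \<and> r - c \<in> H" for r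
  proof (cases "r \<in> H")
    case False
    define H' where "H' = {h + c * r |h c. h \<in> H \<and> c \<in> F}"
    have sub: "H \<subseteq> H'" using zero_mem by (force simp: H'_def)
    have "r \<in> H'" using H(1) H\<^sub>0(1) one_mem by (force simp: H'_def)
    then have "H' \<notin> A" using max[of H'] sub False by blast
    moreover have "u + v \<in> H'" if uv: "u \<in> H'" "v \<in> H'" for u v
    proof -
      obtain h c h' c' where "u = h + c * r" "v = h' + c' * r" "h \<in> H" "h' \<in> H" "c \<in> F" "c' \<in> F"
        using uv unfolding H'_def by blast
      then have "u + v = (h + h') + (c + c') * r" "h + h' \<in> H" "c + c' \<in> F"
        by (auto simp: algebra_simps intro: H add_mem)
      then show ?thesis unfolding H'_def by blast
    qed
    moreover have "d * u \<in> H'" if d: "d \<in> F" and u: "u \<in> H'" for d u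
    proof -
      obtain h c where "u = h + c * r" "h \<in> H" "c \<in> F" using u unfolding H'_def by blast
      then have "d * u = d * h + (d * c) * r" "d * h \<in> H" "d * c \<in> F"
        using d by (auto simp: algebra_simps intro: H mult_mem)
      then show ?thesis unfolding H'_def by blast
    qed
    ultimately have "1 \<in> H'" using sub H(1) unfolding A_def by blast
    then obtain h c where hc: "1 = h + c * r" "h \<in> H" "c \<in> F" unfolding H'_def by blast
    then have h: "h = 1 - c * r" by (metis add_diff_cancel_right')
    have "c \<noteq> 0" using H(2) hc(2) h by auto
    then have "r - inverse c = (- inverse c) * h" by (simp add: h right_diff_distrib)
    also have "\<dots> \<in> H" using hc by (intro H(4) uminus_mem inverse_mem)
    finally show ?thesis using hc inverse_mem by blast
  qed (use zero_mem in auto)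
  define \<epsilon> where "\<epsilon> r = (THE c. c \<in> F \<and> r - c \<in> H)" for r
  have \<epsilon>: "\<epsilon> r \<in> F \<and> r - \<epsilon> r \<in> H" for r
    unfolding \<epsilon>_def by (rule theI') (use ex unique in blast)
  have \<epsilon>I: "\<epsilon> r = c" if "c \<in> F" "r - c \<in> H" for r c
    using unique \<epsilon> that by blast
  show thesis
  proof (rule that)
    show "\<epsilon> r \<in> F" for r using \<epsilon> by blast
    show "\<epsilon> (r + s) = \<epsilon> r + \<epsilon> s" for r s
      using H(3)[of "r - \<epsilon> r" "s - \<epsilon> s"] \<epsilon> by (intro \<epsilon>I add_mem) (auto simp: algebra_simps)
    show "\<epsilon> (c * r) = c * \<epsilon> r" if "c \<in> F" for c r
      using H(4)[of c "r - \<epsilon> r"] \<epsilon> that by (intro \<epsilon>I mult_mem) (auto simp: algebra_simps)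
    show "\<epsilon> 1 = 1" using H(1) H\<^sub>0(1) one_mem by (intro \<epsilon>I) auto
    show "\<epsilon> u = 0" if "u \<in> H\<^sub>0" for u using H(1) that zero_mem by (intro \<epsilon>I) auto
  qed
qed

section \<open>Local nilpotency of two commuting derivations\<close>

locale commuting_derivations = R0: subfield_set R\<^sub>0
  for R\<^sub>0 :: "'r::field set" +
  fixes X Y :: "'r \<Rightarrow> 'r"
  assumes derivX: "derivation X" and derivY: "derivation Y"
    and Y_R0: "r \<in> R\<^sub>0 \<Longrightarrow> Y r \<in> R\<^sub>0"
    and commute: "r \<in> R\<^sub>0 \<Longrightarrow> Y (X r) = X (Y r)"
    and char0: "of_nat (Suc n) \<noteq> (0::'r)"
begin

lemmas X_simps = derivX[THEN derivation_zero] derivX[THEN derivation_add] derivX[THEN derivation_mult]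
  derivX[THEN derivation_uminus] derivX[THEN derivation_diff] derivX[THEN derivation_sum]
lemmas Y_simps = derivY[THEN derivation_zero] derivY[THEN derivation_add] derivY[THEN derivation_mult]
  derivY[THEN derivation_uminus] derivY[THEN derivation_diff] derivY[THEN derivation_sum]

definition F :: "'r set" where
  "F = {r \<in> {r \<in> R\<^sub>0. X r = 0}. Y r = 0}"

sublocale F: subfield_set F
  unfolding F_def
  by (intro subfield_set_derivation_kernel derivX derivY R0.subfield_set_axioms)

lemma F_iff: "r \<in> F \<longleftrightarrow> r \<in> R\<^sub>0 \<and> X r = 0 \<and> Y r = 0"
  by (auto simp: F_def)

text \<open>
  \<open>level N\<close> consists of the elements of \<open>R\<^sub>0\<close> killed by all products of \<open>N\<close> factors \<open>X\<close> or \<open>Y\<close>.  The union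
  \<open>T\<close> of all levels is an \<open>F\<close>-algebra, and \<open>T\<^sub>1\<close> is its subalgebra of constants of \<open>X\<close>.
\<close>

primrec level :: "nat \<Rightarrow> 'r set" where
  "level 0 = {0}"
| "level (Suc N) = {r \<in> R\<^sub>0. X r \<in> level N \<and> Y r \<in> level N}"

lemma zero_level: "0 \<in> level N"
  by (induction N) (auto simp: R0.zero_mem X_simps Y_simps)

lemma level_R0: "r \<in> level N \<Longrightarrow> r \<in> R\<^sub>0"
  by (cases N) (auto simp: R0.zero_mem)

lemma level_Suc: "r \<in> level N \<Longrightarrow> r \<in> level (Suc N)"
  by (induction N arbitrary: r) (auto simp: R0.zero_mem X_simps Y_simps)

lemma level_mono: "r \<in> level N \<Longrightarrow> N \<le> M \<Longrightarrow> r \<in> level M"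
  by (rule subsetD[OF lift_Suc_mono_le[of level]]) (auto simp del: level.simps intro: level_Suc)

lemma level_X: "r \<in> level N \<Longrightarrow> X r \<in> level (N - 1)"
  and level_Y: "r \<in> level N \<Longrightarrow> Y r \<in> level (N - 1)"
  by (cases N; auto simp: X_simps Y_simps)+

lemma level_add: "r \<in> level N \<Longrightarrow> s \<in> level N \<Longrightarrow> r + s \<in> level N"
  by (induction N arbitrary: r s) (auto simp: X_simps Y_simps R0.add_mem)

lemma level_mult: "r \<in> level N \<Longrightarrow> s \<in> level M \<Longrightarrow> r * s \<in> level (N + M)"
proof (induction "N + M" arbitrary: N M r s)
  case (Suc K)
  show ?case
  proof (cases "r = 0 \<or> s = 0")
    case False
    then obtain N' M' where NM: "N = Suc N'" "M = Suc M'"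
      using Suc.prems by (cases N; cases M) auto
    have K: "K = N' + M" "K = N + M'" using Suc.hyps(2) NM by auto
    have "X r \<in> level N'" "Y r \<in> level N'" "X s \<in> level M'" "Y s \<in> level M'"
      using Suc.prems by (auto simp: NM)
    then have "X r * s + r * X s \<in> level K" "Y r * s + r * Y s \<in> level K"
      using Suc.hyps(1)[OF K(1) _ Suc.prems(2)] Suc.hyps(1)[OF K(2) Suc.prems(1)]
      by (auto intro!: level_add simp flip: K)
    moreover have "r * s \<in> R\<^sub>0" using Suc.prems level_R0 by (intro R0.mult_mem)
    ultimately show ?thesis
      unfolding Suc.hyps(2)[symmetric] by (simp add: X_simps Y_simps)
  qed (auto simp: zero_level)
qed auto

definition T :: "'r set" where "T = (\<Union>N. level N)"

definition T\<^sub>1 :: "'r set" where "T\<^sub>1 = {s \<in> T. X s = 0}"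

lemma T_R0: "r \<in> T \<Longrightarrow> r \<in> R\<^sub>0"
  by (auto simp: T_def level_R0)

lemma T_iff: "r \<in> T \<longleftrightarrow> (\<exists>N. r \<in> level N)"
  by (simp add: T_def)

lemma T_zero: "0 \<in> T"
  unfolding T_iff using zero_level by (rule exI)

lemma T_add: "r \<in> T \<Longrightarrow> s \<in> T \<Longrightarrow> r + s \<in> T"
proof -
  assume "r \<in> T" "s \<in> T"
  then obtain N M where "r \<in> level N" "s \<in> level M" by (auto simp: T_def)
  then have "r \<in> level (max N M)" "s \<in> level (max N M)"
    by (simp_all add: level_mono)
  then have "r + s \<in> level (max N M)" by (rule level_add)
  then show ?thesis unfolding T_def by blast
qed

lemma T_mult: "r \<in> T \<Longrightarrow> s \<in> T \<Longrightarrow> r * s \<in> T"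
  unfolding T_iff by (elim exE) (rule exI, rule level_mult)

lemma F_T: "c \<in> F \<Longrightarrow> c \<in> T"
proof -
  assume "c \<in> F"
  then have "c \<in> level (Suc 0)" by (simp add: F_iff)
  then show ?thesis unfolding T_def by blast
qed

lemma T_uminus: "r \<in> T \<Longrightarrow> - r \<in> T"
  using T_mult[OF F_T[OF F.uminus_mem[OF F.one_mem]]] by simp

lemma T_diff: "r \<in> T \<Longrightarrow> s \<in> T \<Longrightarrow> r - s \<in> T"
  using T_add[OF _ T_uminus] by simp

lemma T_X: "r \<in> T \<Longrightarrow> X r \<in> T" and T_Y: "r \<in> T \<Longrightarrow> Y r \<in> T"
  unfolding T_iff by (elim exE, rule exI, erule level_X level_Y)+

lemma T_integrate:
  assumes "r \<in> R\<^sub>0" "X r \<in> T" "Y r \<in> T"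
  shows "r \<in> T"
proof -
  obtain N M where "X r \<in> level N" "Y r \<in> level M" using assms by (auto simp: T_def)
  then have "X r \<in> level (max N M)" "Y r \<in> level (max N M)"
    by (simp_all add: level_mono)
  then have "r \<in> level (Suc (max N M))"
    using assms by simp
  then show ?thesis unfolding T_def by blast
qed

lemma T1_T: "s \<in> T\<^sub>1 \<Longrightarrow> s \<in> T" and T1_X: "s \<in> T\<^sub>1 \<Longrightarrow> X s = 0"
  by (auto simp: T\<^sub>1_def)

lemma F_T1: "c \<in> F \<Longrightarrow> c \<in> T\<^sub>1"
  by (auto simp: T\<^sub>1_def F_T F_iff)

lemma T1_mult: "s \<in> T\<^sub>1 \<Longrightarrow> t \<in> T\<^sub>1 \<Longrightarrow> s * t \<in> T\<^sub>1"
  and T1_add: "s \<in> T\<^sub>1 \<Longrightarrow> t \<in> T\<^sub>1 \<Longrightarrow> s + t \<in> T\<^sub>1"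
  by (auto simp: T\<^sub>1_def T_mult T_add X_simps)

lemma T1_sum: "(\<And>x. x \<in> S \<Longrightarrow> f x \<in> T\<^sub>1) \<Longrightarrow> sum f S \<in> T\<^sub>1"
  by (induction S rule: infinite_finite_induct) (auto intro: F_T1 F.zero_mem T1_add)

lemma T1_Y: "s \<in> T\<^sub>1 \<Longrightarrow> Y s \<in> T\<^sub>1"
  using commute[of s] by (auto simp: T\<^sub>1_def T_Y T_R0 Y_simps)

lemma T1_power: "s \<in> T\<^sub>1 \<Longrightarrow> s ^ n \<in> T\<^sub>1"
  by (induction n) (auto intro: T1_mult F_T1 F.one_mem)

lemma derivatives_level: "r \<in> level N \<Longrightarrow> (X ^^ i) ((Y ^^ j) r) \<in> level (N - (i + j))"
proof -
  assume r: "r \<in> level N"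
  have 1: "(Y ^^ j) r \<in> level (N - j)"
    using r by (induction j) (auto dest: level_Y)
  show ?thesis
  proof (induction i)
    case (Suc i)
    then show ?case using level_X by fastforce
  qed (use 1 in simp)
qed

lemma R0_Y_iterate: "r \<in> R\<^sub>0 \<Longrightarrow> (Y ^^ i) r \<in> R\<^sub>0"
  by (induction i) (auto intro: Y_R0)

lemma Y_iterate_X: "r \<in> R\<^sub>0 \<Longrightarrow> (Y ^^ j) (X r) = X ((Y ^^ j) r)"
  by (induction j) (auto simp: commute R0_Y_iterate)

text \<open>
  If \<open>T\<^sub>1 \<noteq> F\<close>, take \<open>s \<in> T\<^sub>1 - F\<close> of the lowest possible level.  Then \<open>Y s\<close> is a nonzero element of \<open>F\<close>,
  and \<open>a = s / Y s\<close> is a slice: \<open>Y a = 1\<close>.  Integrating repeatedly with respect to \<open>Y\<close> shows that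
  \<open>T\<^sub>1 = F[a]\<close>.  The element \<open>a\<close> is not invertible in \<open>T\<close>, since the successive \<open>Y\<close>-derivatives of
  \<open>1 / a\<close> never vanish.  If \<open>T\<^sub>1 = F\<close>, then \<open>a = 0\<close> does.
\<close>

lemma slice_exists:
  obtains a where "a \<in> T\<^sub>1"
    and "\<And>s. s \<in> T\<^sub>1 \<Longrightarrow> \<exists>c\<in>F. \<exists>s'\<in>T\<^sub>1. s = c + a * s'"
    and "\<And>t. t \<in> T \<Longrightarrow> a * t \<noteq> 1"
proof (cases "T\<^sub>1 \<subseteq> F")
  case True
  show thesis
  proof (rule that[of 0])
    show "0 \<in> T\<^sub>1" by (simp add: F_T1 F.zero_mem)
    show "\<exists>c\<in>F. \<exists>s'\<in>T\<^sub>1. s = c + 0 * s'" if "s \<in> T\<^sub>1" for s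
      using that True by force
  qed simp
next
  case False
  define P where "P N \<longleftrightarrow> (\<exists>s \<in> level N \<inter> T\<^sub>1. s \<notin> F)" for N
  have "\<exists>N. P N" using False unfolding P_def T\<^sub>1_def T_def by blast
  then obtain N where N: "P N" and least: "\<And>M. M < N \<Longrightarrow> \<not> P M"
    using exists_least_iff[of P] by blast
  from N obtain s where s: "s \<in> level N" "s \<in> T\<^sub>1" "s \<notin> F"
    unfolding P_def by blast
  obtain N' where N': "N = Suc N'" using s F.zero_mem by (cases N) auto
  then have "\<not> P N'" using least by simp
  then have YsF: "Y s \<in> F" using s T1_Y unfolding P_def N' by auto
  have "Y s \<noteq> 0" using s by (auto simp: F_iff T\<^sub>1_def T_R0)
  define a where "a = inverse (Y s) * s"
  have a: "a \<in> T\<^sub>1" unfolding a_def by (intro T1_mult F_T1 F.inverse_mem YsF s)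
  have Ya: "Y a = 1"
    using YsF F.inverse_mem[OF YsF] \<open>Y s \<noteq> 0\<close> by (simp add: a_def Y_simps F_iff)
  show thesis
  proof (rule that[OF a])
    have expansion: "\<exists>c n. (\<forall>i. c i \<in> F) \<and> s = (\<Sum>i<n. c i * a ^ i)" if "s \<in> T\<^sub>1" "s \<in> level N" for s N
      using that
    proof (induction N arbitrary: s)
      case 0
      then show ?case using F.zero_mem by (intro exI[of _ "\<lambda>_. 0"]) auto
    next
      case (Suc N)
      then obtain c n where c: "\<And>i. c i \<in> F" and Ys: "Y s = (\<Sum>i<n. c i * a ^ i)"
        using T1_Y by fastforce
      (* Termwise antiderivative of the expansion of Y s in powers of a. *)
      define d where "d i = c i / of_nat (Suc i)" for i
      have d: "d i \<in> F" for i unfolding d_def by (intro F.divide_mem F.of_nat_mem c)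
      let ?p = "\<Sum>i<n. d i * a ^ Suc i"
      have "Y (d i * a ^ Suc i) = c i * a ^ i" for i
        using d[of i] char0[of i]
        by (simp add: F_iff derivation_mult[OF derivY, of "d i"] derivation_power[OF derivY] Ya
             del: of_nat_Suc power_Suc) (simp add: d_def del: of_nat_Suc)
      then have "Y (s - ?p) = 0" by (simp add: Y_simps(5,6) Ys del: power_Suc)
      moreover have p: "?p \<in> T\<^sub>1" by (intro T1_sum T1_mult F_T1 d T1_power a)
      ultimately have F: "s - ?p \<in> F"
        using Suc.prems by (auto simp: F_iff T\<^sub>1_def X_simps(5) intro: T_R0 T_diff)
      define e where "e i = (case i of 0 \<Rightarrow> s - ?p | Suc i \<Rightarrow> d i)" for i
      have "s = (\<Sum>i<Suc n. e i * a ^ i)" by (simp add: sum.lessThan_Suc_shift e_def del: sum.lessThan_Suc)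
      moreover have "e i \<in> F" for i using F d by (auto simp: e_def split: nat.split)
      ultimately show ?case by blast
    qed
    show "\<exists>c\<in>F. \<exists>s'\<in>T\<^sub>1. s = c + a * s'" if s: "s \<in> T\<^sub>1" for s
    proof -
      obtain c n where c: "\<And>i. c i \<in> F" and eq: "s = (\<Sum>i<n. c i * a ^ i)"
        using expansion[OF s] T1_T[OF s] unfolding T_def by blast
      have "s = 0 + a * 0 \<or> (\<exists>m. n = Suc m)" using eq by (cases n) auto
      then show ?thesis
      proof
        assume "\<exists>m. n = Suc m"
        then obtain m where "n = Suc m" ..
        then have "s = c 0 + a * (\<Sum>i<m. c (Suc i) * a ^ i)"
          by (simp add: eq sum.lessThan_Suc_shift sum_distrib_left ac_simps del: sum.lessThan_Suc)
        moreover have "(\<Sum>i<m. c (Suc i) * a ^ i) \<in> T\<^sub>1"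
          by (intro T1_sum T1_mult F_T1 c T1_power a)
        ultimately show ?thesis using c by blast
      qed (use F_T1 F.zero_mem in blast)
    qed
    (* If t = c / a^(j+1), then Y t = - (j+1) c / a^(j+2) is of the same form, one level lower. *)
    have no_inverse: "c = 0" if "t \<in> level N" "c \<in> F" "t * a ^ Suc j = c" for t c j N
      using that
    proof (induction N arbitrary: t c j)
      case (Suc N)
      have "Y (t * a ^ Suc j) = 0"
        using Suc.prems(2,3) by (simp add: F_iff del: power_Suc)
      then have "Y t * a ^ Suc j + t * (of_nat (Suc j) * a ^ j) = 0"
        by (simp add: derivation_mult[OF derivY, of t] derivation_power[OF derivY] Ya
              del: power_Suc of_nat_Suc)
      then have "(Y t * a ^ Suc j + t * (of_nat (Suc j) * a ^ j)) * a = 0" by simp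
      then have "Y t * a ^ Suc (Suc j) + of_nat (Suc j) * (t * a ^ Suc j) = 0"
        by (simp add: algebra_simps del: of_nat_Suc)
      then have "Y t * a ^ Suc (Suc j) = - (of_nat (Suc j) * c)"
        unfolding Suc.prems(3) by (simp add: eq_neg_iff_add_eq_0)
      then have "- (of_nat (Suc j) * c) = 0"
        using Suc.prems by (intro Suc.IH[of "Y t" _ "Suc j"] F.uminus_mem F.mult_mem F.of_nat_mem) auto
      then show ?case using char0[of j] by (simp del: of_nat_Suc)
    qed auto
    show "a * t \<noteq> 1" if "t \<in> T" for t
    proof
      assume "a * t = 1"
      then show False
        using no_inverse[of t _ 1 0] that F.one_mem by (auto simp: T_def mult.commute)
    qed
  qed
qed

text \<open>
  Since \<open>T\<^sub>1 = F + a T\<^sub>1\<close> and \<open>1 \<notin> a T\<close>, any \<open>F\<close>-linear \<open>\<epsilon>\<close> that vanishes on \<open>a T\<close> and satisfies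
  \<open>\<epsilon> 1 = 1\<close> is multiplicative on products of an element of \<open>T\<^sub>1\<close> with one of \<open>T\<close>.
\<close>

lemma multiplicative_functional_exists:
  obtains \<epsilon> where "\<And>r. \<epsilon> r \<in> F" "\<And>r s. \<epsilon> (r + s) = \<epsilon> r + \<epsilon> s"
    "\<And>c r. c \<in> F \<Longrightarrow> \<epsilon> (c * r) = c * \<epsilon> r" "\<epsilon> 1 = 1"
    "\<And>s t. s \<in> T\<^sub>1 \<Longrightarrow> t \<in> T \<Longrightarrow> \<epsilon> (s * t) = \<epsilon> s * \<epsilon> t"
proof -
  obtain a where a: "a \<in> T\<^sub>1"
    and div: "\<And>s. s \<in> T\<^sub>1 \<Longrightarrow> \<exists>c\<in>F. \<exists>s'\<in>T\<^sub>1. s = c + a * s'"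
    and unit: "\<And>t. t \<in> T \<Longrightarrow> a * t \<noteq> 1"
  proof (rule slice_exists)
  qed (rule that)
  obtain \<epsilon> where \<epsilon>: "\<And>r. \<epsilon> r \<in> F" "\<And>r s. \<epsilon> (r + s) = \<epsilon> r + \<epsilon> s"
    "\<And>c r. c \<in> F \<Longrightarrow> \<epsilon> (c * r) = c * \<epsilon> r" "\<epsilon> 1 = 1" "\<And>u. u \<in> (\<lambda>t. a * t) ` T \<Longrightarrow> \<epsilon> u = 0"
  proof (rule F.linear_functional_exists[of "(\<lambda>t. a * t) ` T"])
    show "0 \<in> (\<lambda>t. a * t) ` T" using T_zero by force
    show "u + v \<in> (\<lambda>t. a * t) ` T" if "u \<in> (\<lambda>t. a * t) ` T" "v \<in> (\<lambda>t. a * t) ` T" for u v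
      using that T_add by (auto simp flip: distrib_left)
    show "c * u \<in> (\<lambda>t. a * t) ` T" if "c \<in> F" "u \<in> (\<lambda>t. a * t) ` T" for c u
      using that T_mult[OF F_T] by (auto simp: mult.left_commute)
    show "1 \<notin> (\<lambda>t. a * t) ` T" using unit by fastforce
  qed (rule that)
  have "\<epsilon> (s * t) = \<epsilon> s * \<epsilon> t" if st: "s \<in> T\<^sub>1" "t \<in> T" for s t
  proof -
    obtain c s' where s: "c \<in> F" "s' \<in> T\<^sub>1" "s = c + a * s'" using div[OF st(1)] by blast
    have "\<epsilon> c = c" using \<epsilon>(3)[OF s(1), of 1] \<epsilon>(4) by simp
    moreover have "\<epsilon> (a * s') = 0" using s T1_T by (intro \<epsilon>(5)) auto
    moreover have "\<epsilon> (a * (s' * t)) = 0" using s st T1_T by (intro \<epsilon>(5)) (auto intro: T_mult)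
    ultimately show ?thesis
      by (simp add: s \<epsilon>(2) \<epsilon>(3)[OF s(1)] distrib_right mult.assoc)
  qed
  with \<epsilon> show thesis using that by blast
qed

end

section \<open>Taylor expansion along two commuting derivations\<close>

locale taylor_expansion = commuting_derivations +
  fixes \<epsilon> :: "'a \<Rightarrow> 'a" and x y :: nat
  assumes eps_F: "\<epsilon> r \<in> F" and eps_add: "\<epsilon> (r + s) = \<epsilon> r + \<epsilon> s"
    and eps_scale: "c \<in> F \<Longrightarrow> \<epsilon> (c * r) = c * \<epsilon> r" and eps_one: "\<epsilon> 1 = 1"
    and eps_mult: "s \<in> T\<^sub>1 \<Longrightarrow> t \<in> T \<Longrightarrow> \<epsilon> (s * t) = \<epsilon> s * \<epsilon> t"
    and xy: "x \<noteq> y"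
begin

lemma eps_const: "c \<in> F \<Longrightarrow> \<epsilon> c = c"
  using eps_scale[of c 1] by (simp add: eps_one)

lemma eps_zero: "\<epsilon> 0 = 0"
  by (simp add: eps_const F.zero_mem)

definition taylor_coeff :: "'a \<Rightarrow> (nat \<Rightarrow>\<^sub>0 nat) \<Rightarrow> 'a" where
  "taylor_coeff r m = (if Poly_Mapping.keys m \<subseteq> {x, y} then
     \<epsilon> ((X ^^ Poly_Mapping.lookup m x) ((Y ^^ Poly_Mapping.lookup m y) r)) /
       (of_nat (fact (Poly_Mapping.lookup m x)) * of_nat (fact (Poly_Mapping.lookup m y)))
     else 0)"

definition taylor :: "'a \<Rightarrow> 'a mpoly" where
  "taylor r = Abs_poly_mapping (taylor_coeff r)"

lemma taylor_coeff_high: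
  assumes "r \<in> level N" "N \<le> Poly_Mapping.lookup m x + Poly_Mapping.lookup m y"
  shows "taylor_coeff r m = 0"
  using derivatives_level[OF assms(1), of "Poly_Mapping.lookup m x" "Poly_Mapping.lookup m y"] assms(2)
  by (simp add: taylor_coeff_def eps_zero)

lemma finite_taylor_coeff:
  assumes "r \<in> T"
  shows "finite {m. taylor_coeff r m \<noteq> 0}"
proof -
  obtain N where N: "r \<in> level N" using assms by (auto simp: T_iff)
  let ?f = "\<lambda>(i, j). Poly_Mapping.single x i + Poly_Mapping.single y (j::nat)"
  have "m \<in> ?f ` ({..<N} \<times> {..<N})" if m: "taylor_coeff r m \<noteq> 0" for m
  proof
    show "m = ?f (Poly_Mapping.lookup m x, Poly_Mapping.lookup m y)"
    proof (rule poly_mapping_eqI)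
      fix i
      have "Poly_Mapping.lookup m i = 0" if "i \<noteq> x" "i \<noteq> y"
        using m that by (auto simp: taylor_coeff_def in_keys_iff split: if_splits)
      then show "Poly_Mapping.lookup m i =
          Poly_Mapping.lookup (?f (Poly_Mapping.lookup m x, Poly_Mapping.lookup m y)) i"
        using xy by (auto simp: lookup_add lookup_single when_def)
    qed
    show "(Poly_Mapping.lookup m x, Poly_Mapping.lookup m y) \<in> {..<N} \<times> {..<N}"
      using taylor_coeff_high[OF N, of m] m by (cases "N \<le> Poly_Mapping.lookup m x + Poly_Mapping.lookup m y") auto
  qed
  then have "{m. taylor_coeff r m \<noteq> 0} \<subseteq> ?f ` ({..<N} \<times> {..<N})" by blast
  then show ?thesis by (rule finite_subset) simp
qed

lemma lookup_taylor: "r \<in> T \<Longrightarrow> Poly_Mapping.lookup (taylor r) = taylor_coeff r"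
  unfolding taylor_def by (rule lookup_Abs_poly_mapping) (rule finite_taylor_coeff)

lemma X_iterate_add: "(X ^^ i) (r + s) = (X ^^ i) r + (X ^^ i) s"
  and Y_iterate_add: "(Y ^^ i) (r + s) = (Y ^^ i) r + (Y ^^ i) s"
  by (induction i) (auto simp: X_simps Y_simps)

lemma taylor_add:
  assumes "r \<in> T" "s \<in> T"
  shows "taylor (r + s) = taylor r + taylor s"
  using assms T_add[OF assms]
  by (intro poly_mapping_eqI)
     (auto simp: lookup_taylor lookup_add taylor_coeff_def X_iterate_add Y_iterate_add eps_add
        add_divide_distrib)

lemma taylor_const:
  assumes "c \<in> F"
  shows "taylor c = Poly_Mapping.single 0 c"
proof (rule poly_mapping_eqI)
  fix m :: "nat \<Rightarrow>\<^sub>0 nat"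
  have "c \<in> level (Suc 0)" using assms by (simp add: F_iff)
  note high = taylor_coeff_high[OF this]
  show "Poly_Mapping.lookup (taylor c) m = Poly_Mapping.lookup (Poly_Mapping.single 0 c) m"
  proof (cases "m = 0")
    case True
    then show ?thesis using assms
      by (simp add: lookup_taylor F_T taylor_coeff_def eps_const)
  next
    case False
    have "taylor_coeff c m = 0"
    proof (cases "Poly_Mapping.lookup m x + Poly_Mapping.lookup m y = 0")
      case True
      then have "x \<notin> Poly_Mapping.keys m" "y \<notin> Poly_Mapping.keys m"
        by (auto simp: in_keys_iff)
      then have "\<not> Poly_Mapping.keys m \<subseteq> {x, y}" using False keys_eq_empty[of m] by blast
      then show ?thesis by (simp add: taylor_coeff_def)
    qed (auto intro!: high)
    then show ?thesis using False assms by (simp add: lookup_taylor F_T lookup_single when_def)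
  qed
qed

lemma taylor_zero: "taylor 0 = 0"
  using taylor_const[OF F.zero_mem] by simp

lemma taylor_uminus: "r \<in> T \<Longrightarrow> taylor (- r) = - taylor r"
  using taylor_add[of r "- r"] by (simp add: T_uminus taylor_zero eq_neg_iff_add_eq_0 add.commute)

lemma taylor_diff: "r \<in> T \<Longrightarrow> s \<in> T \<Longrightarrow> taylor (r - s) = taylor r - taylor s"
  using taylor_add[of r "- s"] by (simp add: T_uminus taylor_uminus)

lemma fact_Suc_of_nat: "of_nat (fact (Suc n)) = of_nat (Suc n) * (of_nat (fact n) :: 'a)"
  by (simp only: fact_Suc of_nat_mult of_nat_id)

lemma taylor_X:
  assumes r: "r \<in> T"
  shows "partial_deriv x (taylor r) = taylor (X r)"
proof (rule poly_mapping_eqI)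
  fix m :: "nat \<Rightarrow>\<^sub>0 nat"
  have "(X ^^ Suc i) ((Y ^^ j) r) = (X ^^ i) ((Y ^^ j) (X r))" for i j
    by (simp add: funpow_swap1 Y_iterate_X T_R0[OF r])
  then show "Poly_Mapping.lookup (partial_deriv x (taylor r)) m = Poly_Mapping.lookup (taylor (X r)) m"
    using xy char0[of "Poly_Mapping.lookup m x"]
    by (simp add: lookup_partial_deriv lookup_taylor r T_X taylor_coeff_def keys_add_single[simplified]
          lookup_add lookup_single fact_Suc_of_nat del: of_nat_Suc funpow.simps fact_Suc)
qed

lemma taylor_Y:
  assumes r: "r \<in> T"
  shows "partial_deriv y (taylor r) = taylor (Y r)"
proof (rule poly_mapping_eqI)
  fix m :: "nat \<Rightarrow>\<^sub>0 nat"
  have "(X ^^ i) ((Y ^^ Suc j) r) = (X ^^ i) ((Y ^^ j) (Y r))" for i j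
    by (simp add: funpow_swap1)
  then show "Poly_Mapping.lookup (partial_deriv y (taylor r)) m = Poly_Mapping.lookup (taylor (Y r)) m"
    using xy char0[of "Poly_Mapping.lookup m y"]
    by (simp add: lookup_partial_deriv lookup_taylor r T_Y taylor_coeff_def keys_add_single[simplified]
          lookup_add lookup_single fact_Suc_of_nat del: of_nat_Suc funpow.simps fact_Suc)
qed

lemma taylor_polynomial: "r \<in> T \<Longrightarrow> taylor r \<in> polynomials F {x, y}"
  by (auto simp: F.polynomials_iff lookup_taylor taylor_coeff_def
       intro!: F.divide_mem F.mult_mem F.of_nat_mem eps_F F.zero_mem split: if_splits)

lemma taylor_polynomial_T1:
  assumes s: "s \<in> T\<^sub>1"
  shows "taylor s \<in> polynomials F {y}"
  unfolding F.polynomials_iff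
proof (intro allI conjI impI)
  fix m :: "nat \<Rightarrow>\<^sub>0 nat"
  have p: "taylor s \<in> polynomials F {x, y}" using s by (intro taylor_polynomial T1_T)
  then show "Poly_Mapping.lookup (taylor s) m \<in> F" by (simp add: F.polynomials_iff)
  assume nz: "Poly_Mapping.lookup (taylor s) m \<noteq> 0"
  then have "Poly_Mapping.keys m \<subseteq> {x, y}" using p by (simp add: F.polynomials_iff)
  moreover have "x \<notin> Poly_Mapping.keys m"
  proof
    assume "x \<in> Poly_Mapping.keys m"
    then have m: "m = (m - Poly_Mapping.single x 1) + Poly_Mapping.single x 1" (is "_ = ?m' + _")
      by (intro poly_mapping_eqI) (auto simp: lookup_add lookup_minus lookup_single when_def in_keys_iff)
    have "partial_deriv x (taylor s) = 0"
      by (simp add: taylor_X T1_T[OF s] T1_X[OF s] taylor_zero)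
    then have "of_nat (Suc (Poly_Mapping.lookup ?m' x)) * Poly_Mapping.lookup (taylor s) m = 0"
      using lookup_partial_deriv[of x "taylor s" ?m'] m by simp
    then show False using nz char0 by (simp del: of_nat_Suc)
  qed
  ultimately show "Poly_Mapping.keys m \<subseteq> {y}" by blast
qed

lemma taylor_constant_term: "r \<in> T \<Longrightarrow> Poly_Mapping.lookup (taylor r) 0 = \<epsilon> r"
  by (simp add: lookup_taylor taylor_coeff_def)

text \<open>
  Both sides have the same constant term by the choice of \<open>\<epsilon>\<close>.  By the Leibniz rule their partial
  derivatives are instances of the same identity for factors of lower total level, so induction on
  the sum of the two levels applies.
\<close>

lemma taylor_mult:
  assumes s: "s \<in> T\<^sub>1" and t: "t \<in> T"
  shows "taylor (s * t) = taylor s * taylor t"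
proof -
  have main: "taylor (s * t) = taylor s * taylor t"
    if "s \<in> T\<^sub>1" "s \<in> level N" "t \<in> level M" for s t N M
    using that
  proof (induction "N + M" arbitrary: N M s t rule: less_induct)
    case less
    show ?case
    proof (cases "s = 0 \<or> t = 0")
      case False
      obtain N' where N: "N = Suc N'" using less.prems False by (cases N) auto
      obtain M' where M: "M = Suc M'" using less.prems False by (cases M) auto
      have sT: "s \<in> T" and tT: "t \<in> T" using less.prems by (auto simp: T_iff)
      have X: "taylor (s * X t) = taylor s * taylor (X t)"
        using less.prems by (intro less.hyps[of N M']) (auto simp: M)
      have Y: "taylor (s * Y t) = taylor s * taylor (Y t)"
        using less.prems by (intro less.hyps[of N M']) (auto simp: M)
      have Y': "taylor (Y s * t) = taylor (Y s) * taylor t"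
        using less.prems by (intro less.hyps[of N' M] T1_Y) (auto simp: N)
      show ?thesis
      proof (rule F.polynomial_eqI[OF char0, where V = "{x, y}"])
        show "taylor (s * t) \<in> polynomials F {x, y}"
          by (intro taylor_polynomial T_mult sT tT)
        show "taylor s * taylor t \<in> polynomials F {x, y}"
          by (intro F.polynomials_mult taylor_polynomial sT tT)
        show "partial_deriv i (taylor (s * t)) = partial_deriv i (taylor s * taylor t)"
          if "i \<in> {x, y}" for i
          using that
        proof (elim insertE emptyE)
          assume "i = x"
          then show ?thesis
            using T1_X[OF less.prems(1)] X
            by (simp add: partial_deriv_mult taylor_X T_mult sT tT X_simps taylor_zero)
        next
          assume "i = y"
          then show ?thesis
            by (simp add: partial_deriv_mult taylor_Y T_mult sT tT Y_simps taylor_add T_Y Y Y')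
        qed
        show "Poly_Mapping.lookup (taylor (s * t)) 0 = Poly_Mapping.lookup (taylor s * taylor t) 0"
          by (simp add: lookup_mult_zero taylor_constant_term sT tT T_mult eps_mult less.prems(1))
      qed
    qed (auto simp: taylor_zero)
  qed
  show ?thesis using main s t T1_T[OF s] unfolding T_iff by blast
qed

text \<open>
  The kernel is stable under \<open>X\<close> and \<open>Y\<close>, so a nonzero element of lowest level in it would be killed by
  both and hence lie in \<open>F\<close>.  But there \<open>\<tau>\<close> is the inclusion of constants.
\<close>

lemma taylor_eq_zero:
  assumes "r \<in> T" "taylor r = 0"
  shows "r = 0"
proof -
  have "r = 0" if "r \<in> level N" "taylor r = 0" for r N
    using that
  proof (induction N arbitrary: r)
    case (Suc N)
    then have rT: "r \<in> T" by (auto simp: T_iff simp del: level.simps)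
    have "X r = 0" "Y r = 0"
      using Suc taylor_X[OF rT] taylor_Y[OF rT] by (auto simp: partial_deriv_zero)
    then have "r \<in> F" using T_R0[OF rT] by (simp add: F_iff)
    then have "Poly_Mapping.single (0 :: nat \<Rightarrow>\<^sub>0 nat) r = 0"
      using Suc.prems(2) taylor_const by simp
    then show ?case by (metis lookup_single_eq lookup_zero)
  qed auto
  then show ?thesis using assms by (auto simp: T_iff)
qed

end

section \<open>Combinations of a frame and their embedding\<close>

locale derivation_frame =
  fixes k :: nat and B :: "nat \<Rightarrow> 'r::field \<Rightarrow> 'r" and X Y :: "'r \<Rightarrow> 'r" and g :: "nat \<Rightarrow> 'r"
  assumes char0: "of_nat (Suc n) \<noteq> (0::'r)"
    and derivB: "i \<in> {1..k} \<Longrightarrow> derivation (B i)"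
    and derivX: "derivation X" and derivY: "derivation Y"
    and comm_B: "i \<in> {1..k} \<Longrightarrow> j \<in> {1..k} \<Longrightarrow> B i (B j z) = B j (B i z)"
    and comm_X: "i \<in> {1..k} \<Longrightarrow> B i (X z) = X (B i z)"
    and comm_Y: "i \<in> {1..k} \<Longrightarrow> B i (Y z) = Y (B i z)"
    and bracket_YX: "Y (X z) = X (Y z) + (\<Sum>i=1..k. g i * B i z)"
    and independent: "(\<And>z. c * Y z + s * X z + (\<Sum>i=1..k. r i * B i z) = 0) \<Longrightarrow>
                        c = 0 \<and> s = 0 \<and> (\<forall>i\<in>{1..k}. r i = 0)"
begin

definition comb :: "'r \<Rightarrow> 'r \<Rightarrow> (nat \<Rightarrow> 'r) \<Rightarrow> 'r \<Rightarrow> 'r" where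
  "comb c s r = (\<lambda>z. c * Y z + s * X z + (\<Sum>i=1..k. r i * B i z))"

lemma comb_add: "comb c s r + comb c' s' r' = comb (c + c') (s + s') (\<lambda>i. r i + r' i)"
  by (auto simp: comb_def fun_eq_iff distrib_right sum.distrib)

lemma comb_diff: "comb c s r z - comb c' s' r' z = comb (c - c') (s - s') (\<lambda>i. r i - r' i) z"
  by (auto simp: comb_def left_diff_distrib sum_subtractf)

lemma comb_scale: "pointwise_mult d (comb c s r) = comb (d * c) (d * s) (\<lambda>i. d * r i)"
  by (auto simp: comb_def pointwise_mult_def fun_eq_iff distrib_left sum_distrib_left mult.assoc)

lemma comb_eqD:
  assumes "comb c s r = comb c' s' r'"
  shows "c = c'" "s = s'" "i \<in> {1..k} \<Longrightarrow> r i = r' i"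
proof -
  have "c - c' = 0 \<and> s - s' = 0 \<and> (\<forall>i\<in>{1..k}. r i - r' i = 0)"
  proof (rule independent)
    fix z
    have "comb (c - c') (s - s') (\<lambda>i. r i - r' i) z = 0"
      unfolding comb_diff[symmetric] assms by simp
    then show "(c - c') * Y z + (s - s') * X z + (\<Sum>i=1..k. (r i - r' i) * B i z) = 0"
      by (simp add: comb_def)
  qed
  then show "c = c'" "s = s'" "i \<in> {1..k} \<Longrightarrow> r i = r' i" by auto
qed

lemma comb_cong: "(\<And>i. i \<in> {1..k} \<Longrightarrow> r i = r' i) \<Longrightarrow> comb c s r = comb c s r'"
  unfolding comb_def by (intro ext arg_cong2[of _ _ _ _ "(+)"] refl sum.cong) auto

lemma derivation_comb: "derivation (comb c s r)"
proof -
  have "(\<Sum>i=1..k. r i * B i (u + v)) = (\<Sum>i=1..k. r i * B i u) + (\<Sum>i=1..k. r i * B i v)"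
    and "(\<Sum>i=1..k. r i * B i (u * v)) = (\<Sum>i=1..k. r i * B i u) * v + u * (\<Sum>i=1..k. r i * B i v)"
    for u v
    by (auto simp: derivation_add[OF derivB] derivation_mult[OF derivB] algebra_simps sum.distrib
        sum_distrib_left simp del: One_nat_def intro!: sum.cong)
  then show ?thesis
    unfolding derivation_def comb_def
    by (simp add: derivation_add derivation_mult derivX derivY algebra_simps)
qed

text \<open>
  The Leibniz rule gives \<open>[f D, h E] = f D(h) E - h E(f) D + f h [D, E]\<close>.  The only nonzero bracket of
  basis elements is \<open>[Y, X]\<close>, whence the single correction term.
\<close>

lemma comb_bracket:
  fixes c s r c' s' r'
  defines "D \<equiv> comb c s r" and "E \<equiv> comb c' s' r'"
  shows "lie_bracket D E = comb (D c' - E c) (D s' - E s)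
           (\<lambda>i. D (r' i) - E (r i) + (c * s' - c' * s) * g i)"
proof
  fix z
  have expand: "comb c s r (comb c' s' r' z) =
      comb (comb c s r c') (comb c s r s') (\<lambda>i. comb c s r (r' i)) z +
      (c' * comb c s r (Y z) + s' * comb c s r (X z) + (\<Sum>i=1..k. r' i * comb c s r (B i z)))"
    for c s r c' s' r'
    unfolding comb_def[of c' s' r'] comb_def[of "comb c s r c'"]
    by (simp add: derivation_add[OF derivation_comb] derivation_sum[OF derivation_comb]
         derivation_mult[OF derivation_comb] sum.distrib)
  have inner: "(\<Sum>i=1..k. r' i * comb c s r (B i z)) =
      c * (\<Sum>i=1..k. r' i * Y (B i z)) + s * (\<Sum>i=1..k. r' i * X (B i z)) +
      (\<Sum>i=1..k. \<Sum>j=1..k. r' i * r j * B j (B i z))" for c s r r'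
    unfolding comb_def
    by (simp add: distrib_left sum.distrib sum_distrib_left mult.assoc mult.left_commute)
  have swap: "(\<Sum>i=1..k. \<Sum>j=1..k. r i * r' j * B j (B i z)) =
      (\<Sum>i=1..k. \<Sum>j=1..k. r' i * r j * B j (B i z))"
    by (subst sum.swap) (auto intro!: sum.cong simp: comm_B mult.commute[of "r _"] simp del: One_nat_def)
  have Y: "comb c s r (Y z) = c * Y (Y z) + s * X (Y z) + (\<Sum>i=1..k. r i * Y (B i z))" for c s r
    unfolding comb_def by (auto simp: comm_Y simp del: One_nat_def intro!: sum.cong)
  have X: "comb c s r (X z) = c * X (Y z) + c * (\<Sum>i=1..k. g i * B i z) + s * X (X z) + (\<Sum>i=1..k. r i * X (B i z))" for c s r
    unfolding comb_def by (auto simp: comm_X bracket_YX distrib_left simp del: One_nat_def intro!: sum.cong)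
  have "lie_bracket D E z =
     comb (D c') (D s') (\<lambda>i. D (r' i)) z - comb (E c) (E s) (\<lambda>i. E (r i)) z +
     (c * s' - c' * s) * (\<Sum>i=1..k. g i * B i z)"
    unfolding lie_bracket_def D_def E_def expand inner X Y swap
    by (simp add: algebra_simps)
  also have "\<dots> = comb (D c' - E c) (D s' - E s)
      (\<lambda>i. D (r' i) - E (r i) + (c * s' - c' * s) * g i) z"
    unfolding comb_diff by (simp add: comb_def distrib_right sum.distrib sum_distrib_left mult.assoc)
  finally show "lie_bracket D E z = comb (D c' - E c) (D s' - E s)
      (\<lambda>i. D (r' i) - E (r i) + (c * s' - c' * s) * g i) z" .
qed

definition R\<^sub>0 :: "'r set" where "R\<^sub>0 = constants (B ` {1..k})"

lemma R0_iff: "r \<in> R\<^sub>0 \<longleftrightarrow> (\<forall>i\<in>{1..k}. B i r = 0)"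
  by (auto simp: R\<^sub>0_def constants_def)

sublocale commuting_derivations R\<^sub>0 X Y
proof (intro commuting_derivations.intro commuting_derivations_axioms.intro)
  show "subfield_set R\<^sub>0"
    unfolding R\<^sub>0_def by (rule subfield_set_constants) (use derivB in blast)
  fix r assume r: "r \<in> R\<^sub>0"
  show "Y r \<in> R\<^sub>0"
    using r by (auto simp: R0_iff comm_Y derivation_zero derivY simp del: One_nat_def)
  show "Y (X r) = X (Y r)" using r by (auto simp: bracket_YX R0_iff)
qed (fact derivX derivY char0)+

lemma comb_R0: "t \<in> R\<^sub>0 \<Longrightarrow> comb c s r t = c * Y t + s * X t"
  by (auto simp: comb_def R0_iff)

lemma comb_const: "t \<in> F \<Longrightarrow> comb c s r t = 0"
  by (simp add: F_iff comb_R0)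

text \<open>
  An \<open>F\<close>-Lie algebra that contains \<open>L\<close>, and hence \<open>F L\<close>, when the frame is adapted to \<open>L\<close>.
\<close>

definition envelope :: "('r \<Rightarrow> 'r) set" where
  "envelope = {comb c s r |c s r. c \<in> F \<and> s \<in> T\<^sub>1 \<and> (\<forall>i\<in>{1..k}. r i \<in> T)}"

lemma span_over_subset_envelope:
  assumes L: "L \<subseteq> envelope"
  shows "span_over F L \<subseteq> envelope"
proof
  fix D assume "D \<in> span_over F L"
  then obtain S c where S: "finite S" "S \<subseteq> L" "\<forall>E\<in>S. c E \<in> F"
    and D: "D = (\<Sum>E\<in>S. pointwise_mult (c E) E)" by (auto simp: span_over_def)
  have "comb 0 0 (\<lambda>_. 0) = 0" by (simp add: comb_def fun_eq_iff)
  then have zero: "0 \<in> envelope"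
    unfolding envelope_def using F.zero_mem F_T1[OF F.zero_mem] T_zero by fastforce
  have add: "D + E \<in> envelope" if DE: "D \<in> envelope" "E \<in> envelope" for D E
  proof -
    obtain c s r c' s' r' where "D = comb c s r" "E = comb c' s' r'" "c \<in> F" "c' \<in> F"
      "s \<in> T\<^sub>1" "s' \<in> T\<^sub>1" "\<forall>i\<in>{1..k}. r i \<in> T" "\<forall>i\<in>{1..k}. r' i \<in> T"
      using DE unfolding envelope_def by blast
    then show ?thesis
      unfolding envelope_def using comb_add[of c s r c' s' r'] T1_add F.add_mem T_add
      by (smt (verit) mem_Collect_eq)
  qed
  have scale: "pointwise_mult d D \<in> envelope" if d: "d \<in> F" and D: "D \<in> envelope" for d D
  proof -
    obtain c s r where "D = comb c s r" "c \<in> F" "s \<in> T\<^sub>1" "\<forall>i\<in>{1..k}. r i \<in> T"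
      using D unfolding envelope_def by blast
    then show ?thesis
      unfolding envelope_def using comb_scale[of d c s r] T1_mult[OF F_T1[OF d]] F.mult_mem[OF d] T_mult[OF F_T[OF d]]
      by (smt (verit) mem_Collect_eq)
  qed
  show "D \<in> envelope"
    unfolding D using S
    by (induction S rule: finite_induct) (use zero add scale L in auto)
qed

text \<open>
  Coefficients are sent to their Taylor expansions in \<open>x = x\<^bsub>k+1\<^esub>\<close> and \<open>y = x\<^bsub>k+2\<^esub>\<close>.  The frame elements
  \<open>B\<^sub>i\<close>, \<open>X\<close> go to \<open>\<partial>\<^sub>i\<close>, \<open>\<partial>\<^sub>x\<close>, and \<open>Y\<close> goes to \<open>\<partial>\<^sub>y + \<Sum> h\<^sub>i \<partial>\<^sub>i\<close>, where
  \<open>[\<Sum> h\<^sub>i \<partial>\<^sub>i, \<partial>\<^sub>x] = - \<Sum> (\<partial>\<^sub>x h\<^sub>i) \<partial>\<^sub>i\<close> must be the image \<open>\<Sum> \<tau>(g\<^sub>i) \<partial>\<^sub>i\<close> of \<open>[Y, X]\<close>.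
\<close>

lemma envelope_embedding:
  assumes g: "\<And>i. i \<in> {1..k} \<Longrightarrow> g i \<in> T"
  shows "\<exists>\<phi>. lie_embedding F envelope (triangular (Suc (Suc k)) F) \<phi>"
proof -
  obtain \<epsilon> where \<epsilon>: "\<And>r. \<epsilon> r \<in> F" "\<And>r s. \<epsilon> (r + s) = \<epsilon> r + \<epsilon> s"
    "\<And>c r. c \<in> F \<Longrightarrow> \<epsilon> (c * r) = c * \<epsilon> r" "\<epsilon> 1 = 1"
    "\<And>s t. s \<in> T\<^sub>1 \<Longrightarrow> t \<in> T \<Longrightarrow> \<epsilon> (s * t) = \<epsilon> s * \<epsilon> t"
  proof (rule multiplicative_functional_exists)
  qed (rule that)
  define x where "x = Suc k"
  define y where "y = Suc (Suc k)"
  interpret taylor_expansion R\<^sub>0 X Y \<epsilon> x y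
    by unfold_locales (auto simp: \<epsilon> x_def y_def)
  let ?const = "\<lambda>c. Poly_Mapping.single (0 :: nat \<Rightarrow>\<^sub>0 nat) (c :: 'r)"
  have "\<forall>i. \<exists>q. i \<in> {1..k} \<longrightarrow> q \<in> polynomials F {x, y} \<and> partial_deriv x q = - taylor (g i)"
    using F.polynomial_antiderivative[OF char0 F.polynomials_uminus[OF taylor_polynomial[OF g]], of _ x]
    by (metis insertI1)
  then obtain h where h: "\<And>i. i \<in> {1..k} \<Longrightarrow> h i \<in> polynomials F {x, y}"
    and deriv_h: "\<And>i. i \<in> {1..k} \<Longrightarrow> partial_deriv x (h i) = - taylor (g i)" by metis
  define vec where "vec c s r i =
    (if i = y then ?const c else if i = x then taylor s else taylor (r i) + ?const c * h i)" for c s r i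
  (* By independence of the frame, the coordinates of D on {1..y} do not depend on this choice. *)
  define \<kappa> where "\<kappa> D = (SOME v. \<exists>c s r. c \<in> F \<and> s \<in> T\<^sub>1 \<and> (\<forall>i\<in>{1..k}. r i \<in> T) \<and>
    D = comb c s r \<and> (\<forall>i\<in>{1..y}. v i = vec c s r i))" for D
  have \<kappa>: "\<kappa> (comb c s r) i = vec c s r i"
    if csr: "c \<in> F" "s \<in> T\<^sub>1" "\<forall>i\<in>{1..k}. r i \<in> T" and i: "i \<in> {1..y}" for c s r i
  proof -
    have "\<exists>c' s' r'. c' \<in> F \<and> s' \<in> T\<^sub>1 \<and> (\<forall>i\<in>{1..k}. r' i \<in> T) \<and>
      comb c s r = comb c' s' r' \<and> (\<forall>i\<in>{1..y}. \<kappa> (comb c s r) i = vec c' s' r' i)"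
      unfolding \<kappa>_def by (rule someI[where x = "vec c s r"]) (use csr in blast)
    then obtain c' s' r' where eq: "comb c s r = comb c' s' r'"
      and \<kappa>: "\<forall>i\<in>{1..y}. \<kappa> (comb c s r) i = vec c' s' r' i" by blast
    have "vec c' s' r' i = vec c s r i"
      using comb_eqD[OF eq] i by (auto simp: vec_def x_def y_def)
    then show ?thesis using \<kappa> i by simp
  qed
  have xy_vars: "vector_field y (vec c s r) p = ?const c * partial_deriv y p + taylor s * partial_deriv x p"
    if "p \<in> polynomials F {x, y}" for c s r p
  proof -
    (* The variables x_1, ..., x_k do not occur in p. *)
    have "(\<Sum>i=1..k. vec c s r i * partial_deriv i p) = 0"
      by (rule sum.neutral) (use F.partial_deriv_absent[OF that] in \<open>auto simp: x_def y_def\<close>)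
    then show ?thesis
      by (simp add: vector_field_def y_def x_def vec_def)
  qed
  have envelope_cases: "\<exists>c s r. D = comb c s r \<and> c \<in> F \<and> s \<in> T\<^sub>1 \<and> (\<forall>i\<in>{1..k}. r i \<in> T)"
    if "D \<in> envelope" for D
    using that unfolding envelope_def by blast
  have "lie_embedding F envelope (triangular y F)
     (\<lambda>D p. if p \<in> polynomials F {1..y} then vector_field y (\<kappa> D) p else 0)"
  proof (rule F.lie_embedding_by_coordinates)
    fix D i assume D: "D \<in> envelope" and i: "i \<in> {1..y}"
    obtain c s r where csr: "D = comb c s r" "c \<in> F" "s \<in> T\<^sub>1" "\<forall>i\<in>{1..k}. r i \<in> T"
      using envelope_cases[OF D] by blast
    consider "i = y" | "i = x" | "i \<in> {1..k}" using i by (auto simp: x_def y_def le_Suc_eq)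
    then have "vec c s r i \<in> polynomials F {i<..y}"
    proof cases
      case 1
      then show ?thesis using csr by (simp add: vec_def F.polynomials_const)
    next
      case 2
      have "taylor s \<in> polynomials F {i<..y}"
        by (rule F.polynomials_mono[OF taylor_polynomial_T1[OF csr(3)]]) (use 2 in \<open>auto simp: x_def y_def\<close>)
      then show ?thesis using 2 xy by (simp add: vec_def)
    next
      case 3
      have "taylor (r i) + ?const c * h i \<in> polynomials F {x, y}"
        using 3 csr by (intro F.polynomials_add F.polynomials_mult F.polynomials_const taylor_polynomial h) auto
      then have "taylor (r i) + ?const c * h i \<in> polynomials F {i<..y}"
        by (rule F.polynomials_mono) (use 3 in \<open>auto simp: x_def y_def\<close>)
      then show ?thesis using 3 by (simp add: vec_def x_def y_def)
    qed
    then show "\<kappa> D i \<in> polynomials F {i<..y}" using \<kappa>[OF csr(2-4) i] csr(1) by simp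
  next
    fix D E assume DE: "D \<in> envelope" "E \<in> envelope"
      and eq: "\<And>i. i \<in> {1..y} \<Longrightarrow> \<kappa> D i = \<kappa> E i"
    obtain c s r where csr: "D = comb c s r" "c \<in> F" "s \<in> T\<^sub>1" "\<forall>i\<in>{1..k}. r i \<in> T"
      using envelope_cases[OF DE(1)] by blast
    obtain c' s' r' where csr': "E = comb c' s' r'" "c' \<in> F" "s' \<in> T\<^sub>1" "\<forall>i\<in>{1..k}. r' i \<in> T"
      using envelope_cases[OF DE(2)] by blast
    have eq: "vec c s r i = vec c' s' r' i" if "i \<in> {1..y}" for i
      using eq[OF that] \<kappa>[OF csr(2-4) that] \<kappa>[OF csr'(2-4) that] csr(1) csr'(1) by simp
    have "c = c'" using eq[of y] by (simp add: vec_def y_def) (metis lookup_single_eq)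
    have inj: "u = v" if "u \<in> T" "v \<in> T" "taylor u = taylor v" for u v
      using taylor_eq_zero[of "u - v"] that by (simp add: taylor_diff T_diff)
    have "s = s'" using eq[of x] csr csr' by (intro inj T1_T) (simp_all add: vec_def x_def y_def)
    have "r i = r' i" if "i \<in> {1..k}" for i
      using eq[of i] csr csr' that \<open>c = c'\<close> by (intro inj) (auto simp add: vec_def x_def y_def)
    then show "D = E" using csr(1) csr'(1) \<open>c = c'\<close> \<open>s = s'\<close> comb_cong[of r r'] by simp
  next
    fix D E i assume DE: "D \<in> envelope" "E \<in> envelope" and i: "i \<in> {1..y}"
    obtain c s r where csr: "D = comb c s r" "c \<in> F" "s \<in> T\<^sub>1" "\<forall>i\<in>{1..k}. r i \<in> T"
      using envelope_cases[OF DE(1)] by blast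
    obtain c' s' r' where csr': "E = comb c' s' r'" "c' \<in> F" "s' \<in> T\<^sub>1" "\<forall>i\<in>{1..k}. r' i \<in> T"
      using envelope_cases[OF DE(2)] by blast
    have DE_eqs: "\<kappa> D i = vec c s r i" "\<kappa> E i = vec c' s' r' i"
      unfolding csr(1) csr'(1) using \<kappa>[OF csr(2-4) i] \<kappa>[OF csr'(2-4) i] by auto
    have cases: "P" if "i = y \<Longrightarrow> P" "i = x \<Longrightarrow> P" "\<lbrakk>i \<in> {1..k}; i \<noteq> x; i \<noteq> y\<rbrakk> \<Longrightarrow> P" for P
      using i that by (auto simp: x_def y_def le_Suc_eq)
    have "\<kappa> (D + E) i = vec (c + c') (s + s') (\<lambda>i. r i + r' i) i"
      unfolding csr(1) csr'(1) comb_add using csr csr'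
      by (intro \<kappa> i F.add_mem T1_add ballI T_add) auto
    also have "\<dots> = vec c s r i + vec c' s' r' i"
      by (rule cases) (use csr csr' xy in \<open>auto simp: vec_def single_add taylor_add T1_T distrib_right\<close>)
    finally show "\<kappa> (D + E) i = \<kappa> D i + \<kappa> E i" by (simp add: DE_eqs)

    have D_apply: "D t = c * Y t + s * X t" and E_apply: "E t = c' * Y t + s' * X t" if "t \<in> T" for t
      using T_R0[OF that] by (simp_all add: csr(1) csr'(1) comb_R0)
    have vanish: "D c' = 0" "E c = 0" by (simp_all add: csr(1) csr'(1) comb_const csr(2) csr'(2))
    have T1s: "s \<in> T" "s' \<in> T" "X s = 0" "X s' = 0" using csr(3) csr'(3) T1_T T1_X by auto
    have br: "lie_bracket D E = comb 0 (c * Y s' - c' * Y s)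
        (\<lambda>i. D (r' i) - E (r i) + (c * s' - c' * s) * g i)"
      using comb_bracket[of c s r c' s' r'] vanish
      by (simp add: csr(1)[symmetric] csr'(1)[symmetric] D_apply E_apply T1s)
    have minus_T1: "- u \<in> T\<^sub>1" if "u \<in> T\<^sub>1" for u
      using that by (simp add: T\<^sub>1_def T_uminus X_simps)
    have Ts: "c * Y u + s * X u \<in> T" "c' * Y u + s' * X u \<in> T" if "u \<in> T" for u
      using that F_T[OF csr(2)] F_T[OF csr'(2)] T1s by (auto intro!: T_add T_mult T_X T_Y)
    have DT: "D u \<in> T" "E u \<in> T" if "u \<in> T" for u
      using Ts[OF that] that by (simp_all add: D_apply E_apply)
    have cs: "c * s' - c' * s \<in> T\<^sub>1"
      using csr csr' T1_add[OF T1_mult minus_T1[OF T1_mult], of c s' c' s] by (simp add: F_T1)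
    have "\<kappa> (lie_bracket D E) i = vec 0 (c * Y s' - c' * Y s)
        (\<lambda>i. D (r' i) - E (r i) + (c * s' - c' * s) * g i) i"
      unfolding br
    proof (intro \<kappa> i ballI)
      show "c * Y s' - c' * Y s \<in> T\<^sub>1"
        using csr csr' T1_add[OF T1_mult minus_T1[OF T1_mult], of c "Y s'" c' "Y s"] by (simp add: F_T1 T1_Y)
      show "D (r' j) - E (r j) + (c * s' - c' * s) * g j \<in> T" if "j \<in> {1..k}" for j
        using that csr(4) csr'(4) by (auto intro!: T_add T_diff T_mult DT g T1_T[OF cs])
    qed (rule F.zero_mem)
    also have "\<dots> = vector_field y (\<kappa> D) (\<kappa> E i) - vector_field y (\<kappa> E) (\<kappa> D i)"
    proof -
      have vf: "vector_field y (\<kappa> D) = vector_field y (vec c s r)"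
        "vector_field y (\<kappa> E) = vector_field y (vec c' s' r')"
        using \<kappa>[OF csr(2-4)] \<kappa>[OF csr'(2-4)]
        unfolding vector_field_def csr(1) csr'(1) by auto
      have mult: "taylor (d * u) = ?const d * taylor u" if "d \<in> F" "u \<in> T" for d u
        using that taylor_mult[OF F_T1] taylor_const by simp
      have action: "taylor (d * Y u + v * X u) = ?const d * partial_deriv y (taylor u) + taylor v * partial_deriv x (taylor u)"
        if "d \<in> F" "v \<in> T\<^sub>1" "u \<in> T" for d u v
        using that by (simp add: taylor_add taylor_mult mult taylor_X taylor_Y T_mult T_X T_Y F_T T1_T)
      have field_taylor: "vector_field y (vec c s r) (taylor u) = taylor (c * Y u + s * X u)"
        if "c \<in> F" "s \<in> T\<^sub>1" "u \<in> T" for c s r u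
        using that by (simp only: xy_vars taylor_polynomial action)
      show ?thesis
      proof (rule cases)
        assume iy: "i = y"
        have "vector_field y f (?const d) = 0" for f d
          by (simp add: vector_field_def partial_deriv_const)
        then show ?thesis unfolding vf DE_eqs by (simp add: iy vec_def)
      next
        assume ix: "i = x"
        have "taylor (c * Y s' - c' * Y s) = taylor (c * Y s' + s * X s') - taylor (c' * Y s + s' * X s)"
          using csr csr' T1s by (simp add: taylor_diff T_mult F_T T_Y)
        then show ?thesis
          unfolding vf DE_eqs using ix xy csr(2-4) csr'(2-4) T1s
          by (simp add: vec_def field_taylor)
      next
        assume i: "i \<in> {1..k}" "i \<noteq> x" "i \<noteq> y"
        then have r: "r i \<in> T" "r' i \<in> T" using csr csr' by auto
        have polys: "taylor u + ?const d * h i \<in> polynomials F {x, y}" if "u \<in> T" "d \<in> F" for u d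
          using i that by (intro F.polynomials_add F.polynomials_mult F.polynomials_const taylor_polynomial h)
        have field: "vector_field y (vec c s r) (taylor u + ?const d * h i) =
            taylor (c * Y u + s * X u) + ?const c * ?const d * partial_deriv y (h i) - ?const d * taylor s * taylor (g i)"
          if "c \<in> F" "s \<in> T\<^sub>1" "u \<in> T" "d \<in> F" for c s r u d
          using that unfolding xy_vars[OF polys[OF that(3,4)]]
          by (simp add: partial_deriv_add partial_deriv_mult partial_deriv_const action deriv_h[OF i(1)]
                algebra_simps)
        have "taylor (D (r' i) - E (r i) + (c * s' - c' * s) * g i) =
          taylor (c * Y (r' i) + s * X (r' i)) - taylor (c' * Y (r i) + s' * X (r i)) +
          (?const c * taylor s' - ?const c' * taylor s) * taylor (g i)"
          using csr(2,3) csr'(2,3) T1s r Ts i g cs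
          by (simp add: D_apply E_apply taylor_add taylor_diff T_diff T_mult T1_T taylor_mult mult F_T)
        then show ?thesis
          unfolding vf DE_eqs vec_def[of _ _ _ i] if_not_P[OF i(2)] if_not_P[OF i(3)]
            field[OF csr(2,3) r(2) csr'(2)] field[OF csr'(2,3) r(1) csr(2)]
          by (simp add: algebra_simps)
      qed
    qed
    finally show "\<kappa> (lie_bracket D E) i = vector_field y (\<kappa> D) (\<kappa> E i) - vector_field y (\<kappa> E) (\<kappa> D i)" .
  next
    fix d D i assume d: "d \<in> F" and D: "D \<in> envelope" and i: "i \<in> {1..y}"
    obtain c s r where csr: "D = comb c s r" "c \<in> F" "s \<in> T\<^sub>1" "\<forall>i\<in>{1..k}. r i \<in> T"
      using envelope_cases[OF D] by blast
    have "\<kappa> (pointwise_mult d D) i = vec (d * c) (d * s) (\<lambda>i. d * r i) i"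
      unfolding csr(1) comb_scale using csr d
      by (intro \<kappa> i ballI) (auto intro: F.mult_mem T1_mult T_mult F_T1 F_T)
    also have "\<dots> = poly_scale d (vec c s r i)"
      using csr d i taylor_mult[OF F_T1[OF d]] taylor_const[OF d]
      by (auto simp: vec_def poly_scale_def mult_single T1_T distrib_left mult.assoc[symmetric] x_def y_def le_Suc_eq)
    finally show "\<kappa> (pointwise_mult d D) i = poly_scale d (\<kappa> D i)"
      using \<kappa>[OF csr(2-4) i] csr(1) by simp
  qed
  then show ?thesis unfolding y_def by blast
qed

end

lemma lie_embedding_subset:
  "lie_embedding F G M \<phi> \<Longrightarrow> H \<subseteq> G \<Longrightarrow> lie_embedding F H M \<phi>"
  unfolding lie_embedding_def inj_on_def by blast

section \<open>Frames adapted to a nilpotent Lie algebra\<close>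

locale central_chain =
  fixes L :: "('r::field \<Rightarrow> 'r) set" and S :: "nat \<Rightarrow> ('r \<Rightarrow> 'r) set" and N :: nat
  assumes chain_0: "S 0 = L" and chain_N: "S N = {0}" and chain_subset: "S i \<subseteq> L"
    and chain_bracket: "D \<in> L \<Longrightarrow> E \<in> S i \<Longrightarrow> lie_bracket D E \<in> S (Suc i)"
begin

text \<open>
  Take the last member before the chain enters \<open>P\<close> for the first time.  Brackets of \<open>L\<close> with its
  elements lie in the next member, hence in \<open>P\<close>.
\<close>

lemma central_modulo:
  assumes "0 \<in> P" "\<not> L \<subseteq> P"
  obtains D where "D \<in> L" "D \<notin> P" "\<And>E. E \<in> L \<Longrightarrow> lie_bracket E D \<in> P"
proof -
  define m where "m = (LEAST m. S m \<subseteq> P)"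
  have "S N \<subseteq> P" using assms by (simp add: chain_N)
  then have m: "S m \<subseteq> P" unfolding m_def by (rule LeastI)
  then obtain i where i: "m = Suc i" using assms chain_0 by (cases m) auto
  have "\<not> S i \<subseteq> P" using not_less_Least[of i "\<lambda>m. S m \<subseteq> P"] i m_def by auto
  then obtain D where "D \<in> S i" "D \<notin> P" by blast
  moreover have "lie_bracket E D \<in> P" if "E \<in> L" for E
    using chain_bracket[OF that \<open>D \<in> S i\<close>] m i by blast
  ultimately show thesis using that chain_subset by blast
qed

end

locale nilpotent_frame = derivation_frame k B X Y g + central_chain L S N
  for k and B :: "nat \<Rightarrow> 'r::field \<Rightarrow> 'r" and X Y g L S N +
  assumes B_L: "i \<in> {1..k} \<Longrightarrow> B i \<in> L" and X_L: "X \<in> L" and Y_L: "Y \<in> L"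
    and B_central: "i \<in> {1..k} \<Longrightarrow> E \<in> L \<Longrightarrow> lie_bracket (B i) E = 0"
    and X_central: "E \<in> L \<Longrightarrow> \<exists>r. lie_bracket X E = comb 0 0 r"
    and Y_central: "E \<in> L \<Longrightarrow> \<exists>s r. lie_bracket Y E = comb 0 s r"
    and L_comb: "E \<in> L \<Longrightarrow> \<exists>c s r. E = comb c s r"
begin

lemma B_comb: "i \<in> {1..k} \<Longrightarrow> B i = comb 0 0 (\<lambda>j. if j = i then 1 else 0)"
  by (auto simp: comb_def fun_eq_iff if_distrib[of "\<lambda>c. c * _"] cong: if_cong)

lemma X_comb: "X = comb 0 1 (\<lambda>_. 0)" and Y_comb: "Y = comb 1 0 (\<lambda>_. 0)"
  by (auto simp: comb_def fun_eq_iff)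

lemma zero_comb: "0 = comb 0 0 (\<lambda>_. 0)"
  by (auto simp: comb_def fun_eq_iff)

lemma bracket_B: "i \<in> {1..k} \<Longrightarrow>
    lie_bracket (B i) (comb c s r) = comb (B i c) (B i s) (\<lambda>j. B i (r j))"
  using comb_bracket[of 0 0 "\<lambda>j. if j = i then 1 else 0" c s r]
  by (simp add: B_comb[symmetric] if_distrib[of "comb c s r"] derivation_zero[OF derivation_comb]
      derivation_one[OF derivation_comb] cong: if_cong)

lemma bracket_X: "lie_bracket X (comb c s r) = comb (X c) (X s) (\<lambda>i. X (r i) - c * g i)"
  using comb_bracket[of 0 1 "\<lambda>_. 0" c s r]
  by (simp add: X_comb[symmetric] derivation_zero[OF derivation_comb] derivation_one[OF derivation_comb])

lemma bracket_Y: "lie_bracket Y (comb c s r) = comb (Y c) (Y s) (\<lambda>i. Y (r i) + s * g i)"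
  using comb_bracket[of 1 0 "\<lambda>_. 0" c s r]
  by (simp add: Y_comb[symmetric] derivation_zero[OF derivation_comb] derivation_one[OF derivation_comb])

text \<open>
  Each of the three kinds of brackets lies in a smaller span, so its remaining coefficients vanish.
\<close>

lemma coefficients:
  assumes E: "comb c s r \<in> L"
  shows "c \<in> F" "s \<in> R\<^sub>0" "X s = 0" "\<And>i. i \<in> {1..k} \<Longrightarrow> r i \<in> R\<^sub>0"
proof -
  have B: "comb (B i c) (B i s) (\<lambda>j. B i (r j)) = comb 0 0 (\<lambda>_. 0)" if "i \<in> {1..k}" for i
    using B_central[OF that E] bracket_B[OF that] zero_comb by simp
  show "s \<in> R\<^sub>0" "\<And>i. i \<in> {1..k} \<Longrightarrow> r i \<in> R\<^sub>0"
    using comb_eqD[OF B] by (auto simp: R0_iff)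
  obtain r' where X: "comb (X c) (X s) (\<lambda>i. X (r i) - c * g i) = comb 0 0 r'"
    using X_central[OF E] bracket_X by auto
  show "X s = 0" using comb_eqD(2)[OF X] .
  obtain s' r'' where Y: "comb (Y c) (Y s) (\<lambda>i. Y (r i) + s * g i) = comb 0 s' r''"
    using Y_central[OF E] bracket_Y by auto
  show "c \<in> F" using comb_eqD(1)[OF B] comb_eqD(1)[OF X] comb_eqD(1)[OF Y] by (auto simp: F_iff R0_iff)
qed

lemma constants_eq: "constants L = F"
proof
  show "constants L \<subseteq> F" using B_L X_L Y_L by (auto simp: constants_def F_iff R0_iff)
  show "F \<subseteq> constants L"
  proof
    fix t assume "t \<in> F"
    then have "E t = 0" if "E \<in> L" for E using L_comb[OF that] comb_const by auto
    then show "t \<in> constants L" by (simp add: constants_def)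
  qed
qed

text \<open>
  Bracketing \<open>\<Sum> r\<^sub>i B\<^sub>i\<close> with \<open>X\<close> or \<open>Y\<close> differentiates all \<open>r\<^sub>i\<close> and moves one step down the central
  chain.  Applied to \<open>[Y, X]\<close>, this puts the \<open>g\<^sub>i\<close> into \<open>T\<close>, which the general case below uses.
\<close>

lemma coefficient_in_T:
  assumes "comb 0 0 r \<in> L" "i \<in> {1..k}"
  shows "r i \<in> T"
proof -
  have main: "\<forall>r. comb 0 0 r \<in> S m \<longrightarrow> r i \<in> T" if "m \<le> N" for m
    using that
  proof (induction rule: inc_induct)
    case base
    have "r i \<in> T" if "comb 0 0 r \<in> S N" for r
    proof -
      have "comb 0 0 r = comb 0 0 (\<lambda>_. 0)" using that chain_N zero_comb by simp
      then show ?thesis using comb_eqD(3)[OF _ assms(2)] T_zero by metis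
    qed
    then show ?case by blast
  next
    case (step m)
    show ?case
    proof (intro allI impI)
      fix r assume r: "comb 0 0 r \<in> S m"
      have XY: "comb 0 0 (\<lambda>i. X (r i)) \<in> S (Suc m)" "comb 0 0 (\<lambda>i. Y (r i)) \<in> S (Suc m)"
        using chain_bracket[OF X_L r] chain_bracket[OF Y_L r] bracket_X[of 0 0 r] bracket_Y[of 0 0 r]
        by (simp_all add: X_simps Y_simps)
      have "X (r i) \<in> T" "Y (r i) \<in> T"
        using step.IH[rule_format, OF XY(1)] step.IH[rule_format, OF XY(2)] by simp_all
      moreover have "r i \<in> R\<^sub>0" using coefficients(4)[OF subsetD[OF chain_subset r] assms(2)] .
      ultimately show "r i \<in> T" by (simp add: T_integrate)
    qed
  qed
  show ?thesis using main[of 0] assms chain_0 by simp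
qed

lemma g_in_T:
  assumes "i \<in> {1..k}"
  shows "g i \<in> T"
proof (rule coefficient_in_T)
  have "lie_bracket Y X = comb 0 0 g" by (simp add: lie_bracket_def comb_def bracket_YX fun_eq_iff)
  moreover have "lie_bracket Y X \<in> L" using chain_bracket[of Y X 0] X_L Y_L chain_0 chain_subset by blast
  ultimately show "comb 0 0 g \<in> L" by simp
qed fact

text \<open>
  The descent along the chain is as before.  The brackets now contain the extra terms \<open>c g\<^sub>i\<close> and
  \<open>s g\<^sub>i\<close>, which lie in \<open>T\<close> because \<open>T\<close> is closed under products.
\<close>

lemma coefficients_in_T:
  assumes "comb c s r \<in> L"
  shows "s \<in> T" "i \<in> {1..k} \<Longrightarrow> r i \<in> T"
proof -
  have main: "\<forall>c s r. comb c s r \<in> S m \<longrightarrow> s \<in> T \<and> (\<forall>i\<in>{1..k}. r i \<in> T)" if "m \<le> N" for m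
    using that
  proof (induction rule: inc_induct)
    case base
    have "s \<in> T \<and> (\<forall>i\<in>{1..k}. r i \<in> T)" if "comb c s r \<in> S N" for c s r
    proof -
      have eq: "comb c s r = comb 0 0 (\<lambda>_. 0)" using that chain_N zero_comb by simp
      show ?thesis using comb_eqD[OF eq] T_zero by simp
    qed
    then show ?case by blast
  next
    case (step m)
    show ?case
    proof (intro allI impI)
      fix c s r assume csr: "comb c s r \<in> S m"
      then have L: "comb c s r \<in> L" using chain_subset by blast
      note coeffs = coefficients[OF L]
      have "c \<in> T" using coeffs(1) by (rule F_T)
      have XE: "comb (X c) (X s) (\<lambda>i. X (r i) - c * g i) \<in> S (Suc m)"
        using chain_bracket[OF X_L csr] by (simp add: bracket_X)
      have YE: "comb (Y c) (Y s) (\<lambda>i. Y (r i) + s * g i) \<in> S (Suc m)"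
        using chain_bracket[OF Y_L csr] by (simp add: bracket_Y)
      have "Y s \<in> T" using step.IH[rule_format, OF YE] by simp
      then have s: "s \<in> T" using coeffs(2,3) T_zero by (simp add: T_integrate)
      have "r i \<in> T" if i: "i \<in> {1..k}" for i
      proof (rule T_integrate)
        have "X (r i) - c * g i \<in> T" using step.IH[rule_format, OF XE] i by simp
        from T_add[OF this T_mult[OF \<open>c \<in> T\<close> g_in_T[OF i]]] show "X (r i) \<in> T" by simp
        have "Y (r i) + s * g i \<in> T" using step.IH[rule_format, OF YE] i by simp
        from T_diff[OF this T_mult[OF s g_in_T[OF i]]] show "Y (r i) \<in> T" by simp
      qed (rule coeffs(4)[OF i])
      then show "s \<in> T \<and> (\<forall>i\<in>{1..k}. r i \<in> T)" using s by blast
    qed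
  qed
  have "comb c s r \<in> S 0" using assms chain_0 by simp
  note main[OF le0, rule_format, OF this]
  then show "s \<in> T" "i \<in> {1..k} \<Longrightarrow> r i \<in> T" by simp_all
qed

lemma L_subset_envelope: "L \<subseteq> envelope"
proof
  fix E assume E: "E \<in> L"
  then obtain c s r where csr: "E = comb c s r" using L_comb by blast
  have "c \<in> F" "s \<in> T\<^sub>1" "\<forall>i\<in>{1..k}. r i \<in> T"
    using coefficients[of c s r] coefficients_in_T[of c s r] E unfolding csr by (auto simp: T\<^sub>1_def)
  then show "E \<in> envelope" unfolding envelope_def csr by blast
qed

lemma embedding:
  "\<exists>\<phi>. lie_embedding (constants L) (span_over (constants L) L) (triangular (Suc (Suc k)) (constants L)) \<phi>"
  using envelope_embedding[OF g_in_T] span_over_subset_envelope[OF L_subset_envelope] lie_embedding_subset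
  unfolding constants_eq by blast

end

section \<open>Subalgebras of W(A) and their rank\<close>

lemma W_derivation:
  fixes sc :: "'k::field_char_0 \<Rightarrow> 'a::idom \<Rightarrow> 'a"
  assumes "D \<in> W sc"
  shows "derivation D"
proof -
  have "fract_op.span (extended_derivations sc) \<subseteq> {D. derivation D}"
  proof (rule fract_op.span_minimal)
    show "extended_derivations sc \<subseteq> {D. derivation D}"
      by (auto simp: extended_derivations_def derivations_def derivation_def)
    show "fract_op.subspace {D. derivation D}"
      by (auto simp: fract_op.subspace_def derivation_def pointwise_mult_def algebra_simps)
  qed
  then show ?thesis using assms by (auto simp: W_def)
qed

lemma of_nat_fract_neq_zero:
  fixes sc :: "'k::field_char_0 \<Rightarrow> 'a::idom \<Rightarrow> 'a"
  assumes "algebra_over_field sc"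
  shows "of_nat (Suc n) \<noteq> (0 :: 'a fract)"
proof -
  interpret algebra_over_field sc by fact
  have "sc (of_nat n) 1 = of_nat n" for n
    by (induction n) (auto simp: scale_left_distrib)
  then have "of_nat (Suc n) \<noteq> (0 :: 'a)"
    by (metis of_nat_neq_0 scale_eq_0_iff zero_neq_one)
  moreover have "of_nat n = to_fract (of_nat n :: 'a)" for n
    by (induction n) auto
  ultimately show ?thesis by (metis to_fract_eq_0_iff)
qed

lemma lower_central_series_chain:
  fixes sc :: "'k::field_char_0 \<Rightarrow> 'a::idom \<Rightarrow> 'a"
  assumes alg: "algebra_over_field sc" and L: "lie_subalgebra sc M L"
    and N: "lower_central_series sc L N = {0}"
  shows "central_chain L (lower_central_series sc L) N"
proof -
  interpret algebra_over_field sc by fact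
  interpret G: module "ground_scale sc"
  proof
    have add: "to_fract (sc (c + d) 1) = to_fract (sc c 1) + to_fract (sc d 1)" for c d
      by (simp add: scale_left_distrib)
    have mult: "to_fract (sc (c * d) 1) = to_fract (sc c 1) * to_fract (sc d 1)" for c d
      using scale_mult_left[of c 1 "sc d 1"] by simp
    fix c d and D E :: "'a fract \<Rightarrow> 'a fract"
    show "ground_scale sc c (D + E) = ground_scale sc c D + ground_scale sc c E"
      "ground_scale sc (c + d) D = ground_scale sc c D + ground_scale sc d D"
      "ground_scale sc c (ground_scale sc d D) = ground_scale sc (c * d) D"
      "ground_scale sc 1 D = D"
      by (auto simp: ground_scale_def fract_scale_def fun_eq_iff distrib_left distrib_right add mult mult.assoc)
  qed
  have sub: "lower_central_series sc L i \<subseteq> L" for i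
  proof (induction i)
    case (Suc i)
    show ?case
      unfolding lower_central_series.simps
      by (rule G.span_minimal) (use Suc L in \<open>auto simp: lie_subalgebra_def\<close>)
  qed simp
  show ?thesis
  proof
    show "lie_bracket D E \<in> lower_central_series sc L (Suc i)"
      if "D \<in> L" "E \<in> lower_central_series sc L i" for D E i
      unfolding lower_central_series.simps by (rule G.span_base) (use that in blast)
  qed (use sub N in auto)
qed

lemma in_span_image_iff:
  fixes B :: "'i \<Rightarrow> 'a::idom fract \<Rightarrow> 'a fract"
  assumes I: "finite I"
  shows "D \<in> fract_op.span (B ` I) \<longleftrightarrow> (\<exists>r. D = (\<lambda>z. \<Sum>i\<in>I. r i * B i z))"
proof
  have "fract_op.span (B ` I) \<subseteq> {\<lambda>z. \<Sum>i\<in>I. r i * B i z |r. True}"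
  proof (rule fract_op.span_minimal)
    have "B i = (\<lambda>z. \<Sum>j\<in>I. (if j = i then 1 else 0) * B j z)" if "i \<in> I" for i
      using that I by (simp add: fun_eq_iff if_distrib[of "\<lambda>c. c * _"] cong: if_cong)
    then have "\<exists>r. B i = (\<lambda>z. \<Sum>j\<in>I. r j * B j z)" if "i \<in> I" for i
      using that by (intro exI[of _ "\<lambda>j. if j = i then 1 else 0"])
    then show "B ` I \<subseteq> {\<lambda>z. \<Sum>i\<in>I. r i * B i z |r. True}" by blast
    show "fract_op.subspace {\<lambda>z. \<Sum>i\<in>I. r i * B i z |r. True}"
      unfolding fract_op.subspace_def
    proof (intro conjI ballI allI)
      show "0 \<in> {\<lambda>z. \<Sum>i\<in>I. r i * B i z |r. True}"
        unfolding mem_Collect_eq by (rule exI[of _ "\<lambda>_. 0"]) (simp add: fun_eq_iff)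
      fix D E assume "D \<in> {\<lambda>z. \<Sum>i\<in>I. r i * B i z |r. True}"
      then obtain r where D: "D = (\<lambda>z. \<Sum>i\<in>I. r i * B i z)" by blast
      show "pointwise_mult c D \<in> {\<lambda>z. \<Sum>i\<in>I. r i * B i z |r. True}" for c
        unfolding mem_Collect_eq
        by (rule exI[of _ "\<lambda>i. c * r i"]) (simp add: D pointwise_mult_def sum_distrib_left mult.assoc)
      assume "E \<in> {\<lambda>z. \<Sum>i\<in>I. r i * B i z |r. True}"
      then obtain r' where E: "E = (\<lambda>z. \<Sum>i\<in>I. r' i * B i z)" by blast
      show "D + E \<in> {\<lambda>z. \<Sum>i\<in>I. r i * B i z |r. True}"
        unfolding mem_Collect_eq
        by (rule exI[of _ "\<lambda>i. r i + r' i"]) (simp add: D E fun_eq_iff distrib_right sum.distrib)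
    qed
  qed
  then show "D \<in> fract_op.span (B ` I) \<Longrightarrow> \<exists>r. D = (\<lambda>z. \<Sum>i\<in>I. r i * B i z)" by blast
next
  assume "\<exists>r. D = (\<lambda>z. \<Sum>i\<in>I. r i * B i z)"
  then obtain r where "D = (\<lambda>z. \<Sum>i\<in>I. r i * B i z)" by blast
  moreover have "(\<Sum>i\<in>I'. pointwise_mult (r i) (B i)) = (\<lambda>z. \<Sum>i\<in>I'. r i * B i z)" for I'
    by (induction I' rule: infinite_finite_induct) (auto simp: pointwise_mult_def fun_eq_iff)
  ultimately have "D = (\<Sum>i\<in>I. pointwise_mult (r i) (B i))" by simp
  then show "D \<in> fract_op.span (B ` I)"
    by (simp add: fract_op.span_sum fract_op.span_scale fract_op.span_base)
qed

lemma subset_of_center_exists: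
  fixes C :: "('a::idom fract \<Rightarrow> 'a fract) set"
  assumes "k \<le> rk C"
  obtains Z where "Z \<subseteq> C" "fract_op.independent Z" "finite Z" "card Z = k"
proof -
  obtain B where B: "B \<subseteq> C" "fract_op.independent B" "C \<subseteq> fract_op.span B" "card B = fract_op.dim C"
    by (rule fract_op.basis_exists)
  have "k \<le> card B" using assms B(4) by (simp add: rk_def)
  then obtain Z where "Z \<subseteq> B" "card Z = k" "finite Z" by (rule obtain_subset_with_card_n)
  show thesis
  proof (rule that)
    show "Z \<subseteq> C" using \<open>Z \<subseteq> B\<close> B(1) by blast
    show "fract_op.independent Z" by (rule fract_op.independent_mono[OF B(2) \<open>Z \<subseteq> B\<close>])
  qed fact+
qed

lemma finite_rank_basis:
  assumes "finite_rank L"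
  obtains B where "B \<subseteq> L" "fract_op.independent B" "L \<subseteq> fract_op.span B" "finite B" "card B = rk L"
proof -
  obtain B where B: "B \<subseteq> L" "fract_op.independent B" "L \<subseteq> fract_op.span B" "card B = fract_op.dim L"
    by (rule fract_op.basis_exists)
  obtain G where G: "finite G" "fract_op.span G = fract_op.span L"
    using assms unfolding finite_rank_def by blast
  have "B \<subseteq> fract_op.span G" unfolding G(2) using B(1) fract_op.span_superset by (rule subset_trans)
  then have "finite B" using fract_op.independent_span_bound[OF G(1) B(2)] by simp
  then show thesis using B by (intro that[of B]) (simp_all add: rk_def)
qed

lemma independent_card_le_rk:
  assumes "finite_rank L" "C \<subseteq> L" "fract_op.independent C"
  shows "finite C \<and> card C \<le> rk L"
proof -
  obtain B where B: "L \<subseteq> fract_op.span B" "finite B" "card B = rk L"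
    by (rule finite_rank_basis[OF assms(1)])
  have "C \<subseteq> fract_op.span B" using assms B by blast
  then show ?thesis using fract_op.independent_span_bound[OF B(2) assms(3)] B(3) by simp
qed

lemma not_subset_span:
  assumes "finite C" "card C < rk L"
  shows "\<not> L \<subseteq> fract_op.span C"
  using fract_op.dim_le_card[of L C] assms by (auto simp: rk_def)

lemma subset_span_of_independent:
  assumes "finite_rank L" "C \<subseteq> L" "fract_op.independent C" "card C = rk L"
  shows "L \<subseteq> fract_op.span C"
proof
  fix D assume D: "D \<in> L"
  show "D \<in> fract_op.span C"
  proof (rule ccontr)
    assume nin: "D \<notin> fract_op.span C"
    then have "fract_op.independent (insert D C)" using assms by (intro fract_op.independent_insertI)
    then have "finite (insert D C)" "card (insert D C) \<le> rk L"
      using independent_card_le_rk[OF assms(1), of "insert D C"] D assms by auto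
    moreover have "D \<notin> C" using nin fract_op.span_base by blast
    ultimately show False using assms(4) by simp
  qed
qed

section \<open>Rank at most one\<close>

lemma rank_one_embedding:
  fixes D :: "'r::field \<Rightarrow> 'r"
  assumes F: "subfield_set F" and DF: "\<And>t. t \<in> F \<Longrightarrow> D t = 0" and D: "derivation D" "D \<noteq> 0"
    and L: "L \<subseteq> {pointwise_mult c D |c. c \<in> F}"
  shows "\<exists>\<phi>. lie_embedding F (span_over F L) (triangular 1 F) \<phi>"
proof -
  interpret F: subfield_set F by fact
  let ?G = "{pointwise_mult c D |c. c \<in> F}"
  have inj: "c = d" if "pointwise_mult c D = pointwise_mult d D" for c d
  proof -
    obtain z where "D z \<noteq> 0" using D(2) by (auto simp: fun_eq_iff)
    then show ?thesis using fun_cong[OF that, of z] by (simp add: pointwise_mult_def)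
  qed
  define \<kappa> :: "('r \<Rightarrow> 'r) \<Rightarrow> nat \<Rightarrow> 'r mpoly"
    where "\<kappa> E i = Poly_Mapping.single 0 (THE c. E = pointwise_mult c D)" for E i
  have \<kappa>: "\<kappa> (pointwise_mult c D) i = Poly_Mapping.single 0 c" for c i
    unfolding \<kappa>_def using inj by (intro arg_cong[of _ _ "Poly_Mapping.single 0"] the_equality) auto
  have add: "pointwise_mult c D + pointwise_mult d D = pointwise_mult (c + d) D" for c d
    by (auto simp: pointwise_mult_def fun_eq_iff distrib_right)
  have scale: "pointwise_mult c (pointwise_mult d D) = pointwise_mult (c * d) D" for c d
    by (auto simp: pointwise_mult_def fun_eq_iff)
  have bracket: "lie_bracket (pointwise_mult c D) (pointwise_mult d D) = pointwise_mult 0 D"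
    if "c \<in> F" "d \<in> F" for c d
    using that by (auto simp: pointwise_mult_def lie_bracket_def fun_eq_iff derivation_mult[OF D(1)] DF)
  have "lie_embedding F ?G (triangular 1 F)
     (\<lambda>D p. if p \<in> polynomials F {1..1} then vector_field 1 (\<kappa> D) p else 0)"
  proof (rule F.lie_embedding_by_coordinates)
    show "D1 = D2" if "D1 \<in> ?G" "D2 \<in> ?G" "\<And>i. i \<in> {1..1} \<Longrightarrow> \<kappa> D1 i = \<kappa> D2 i" for D1 D2
      using that by (auto simp: \<kappa>) (metis lookup_single_eq)
  qed (auto simp: \<kappa> add scale bracket F.polynomials_const single_add poly_scale_def mult_single
        vector_field_def partial_deriv_const)
  moreover have "span_over F L \<subseteq> ?G"
  proof
    fix E assume "E \<in> span_over F L"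
    then obtain S c where S: "finite S" "S \<subseteq> L" "\<forall>E\<in>S. c E \<in> F"
      and E: "E = (\<Sum>E\<in>S. pointwise_mult (c E) E)" by (auto simp: span_over_def)
    have "0 = pointwise_mult 0 D" by (simp add: pointwise_mult_def fun_eq_iff)
    then have zero: "0 \<in> ?G" using F.zero_mem by blast
    show "E \<in> ?G"
      unfolding E using S
    proof (induction S rule: finite_induct)
      case (insert E' S)
      then have "E' \<in> ?G" using L by blast
      then obtain d where "E' = pointwise_mult d D" "d \<in> F" by blast
      moreover obtain e where "(\<Sum>E\<in>S. pointwise_mult (c E) E) = pointwise_mult e D" "e \<in> F"
        using insert by auto
      ultimately have "(\<Sum>E\<in>insert E' S. pointwise_mult (c E) E) = pointwise_mult (c E' * d + e) D"
        "c E' * d + e \<in> F"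
        using insert by (auto simp: scale add intro: F.add_mem F.mult_mem)
      then show ?case by blast
    qed (use zero in simp)
  qed
  ultimately show ?thesis using lie_embedding_subset by blast
qed

text \<open>
  A nonzero central \<open>D \<in> L\<close> spans \<open>L\<close> over \<open>R\<close> when the rank is one, and \<open>[c D, D] = - D(c) D\<close> shows that
  the coefficients are constants.
\<close>

lemma embedding_rank_at_most_one:
  fixes L :: "('a::idom fract \<Rightarrow> 'a fract) set"
  assumes chain: "central_chain L S N" and deriv: "\<And>D. D \<in> L \<Longrightarrow> derivation D"
    and fin: "finite_rank L" and rk: "rk L \<le> 1"
  shows "\<exists>\<phi>. lie_embedding (constants L) (span_over (constants L) L) (triangular (rk L) (constants L)) \<phi>"
proof -
  interpret central_chain L S N by fact
  interpret F: subfield_set "constants L" by (rule subfield_set_constants) (rule deriv)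
  show ?thesis
  proof (cases "rk L = 0")
    case True
    then have L: "L \<subseteq> {0}"
      using subset_span_of_independent[OF fin, of "{}"] fract_op.independent_empty by simp
    have sub: "span_over (constants L) L \<subseteq> {0}"
    proof
      fix E assume "E \<in> span_over (constants L) L"
      then obtain S c where S: "S \<subseteq> L" "E = (\<Sum>D\<in>S. pointwise_mult (c D) D)"
        by (auto simp: span_over_def)
      have "pointwise_mult (c D) D = 0" if "D \<in> S" for D
        using that S(1) L by (auto simp: pointwise_mult_def fun_eq_iff)
      then show "E \<in> {0}" unfolding S(2) singleton_iff by (intro sum.neutral ballI)
    qed
    have "lie_embedding (constants L) {0} (triangular 0 (constants L))
        (\<lambda>D p. if p \<in> polynomials (constants L) {1..0} then vector_field 0 (\<lambda>_. 0) p else 0)"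
      by (rule F.lie_embedding_by_coordinates) auto
    note lie_embedding_subset[OF this sub]
    then show ?thesis unfolding True by (intro exI)
  next
    case False
    then have rk: "rk L = 1" using rk by simp
    have "\<not> L \<subseteq> {0}" using not_subset_span[of "{}" L] rk by simp
    then obtain D where D: "D \<in> L" "D \<noteq> 0" "\<And>E. E \<in> L \<Longrightarrow> lie_bracket E D = 0"
      using central_modulo[of "{0}"] by auto
    have "L \<subseteq> fract_op.span {D}"
      using D rk by (intro subset_span_of_independent fin) (auto simp: fract_op.dependent_single)
    have multiples: "L \<subseteq> {pointwise_mult c D |c. c \<in> constants L}"
    proof
      fix E assume E: "E \<in> L"
      have multiple: "\<exists>c. E' = pointwise_mult c D" if "E' \<in> L" for E'
        using that \<open>L \<subseteq> fract_op.span {D}\<close> by (auto simp: fract_op.span_singleton)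
      obtain c where c: "E = pointwise_mult c D" using multiple[OF E] by blast
      obtain z where z: "D z \<noteq> 0" using D(2) by (auto simp: fun_eq_iff)
      have "lie_bracket E D z = - D c * D z"
        by (simp add: c lie_bracket_def pointwise_mult_def derivation_mult[OF deriv[OF D(1)]])
      then have "D c = 0" using D(3)[OF E] z by simp
      have "E' c = 0" if E': "E' \<in> L" for E'
      proof -
        obtain d where "E' = pointwise_mult d D" using multiple[OF E'] by blast
        then show ?thesis using \<open>D c = 0\<close> by (simp add: pointwise_mult_def)
      qed
      then have "c \<in> constants L" by (simp add: constants_def)
      then show "E \<in> {pointwise_mult c D |c. c \<in> constants L}" using c by blast
    qed
    show ?thesis
      unfolding rk
      by (rule rank_one_embedding[OF F.subfield_set_axioms _ deriv[OF D(1)] D(2) multiples])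
         (use D(1) in \<open>simp add: constants_def\<close>)
  qed
qed

section \<open>Center of corank at most two\<close>

text \<open>
  The frame is built from a part \<open>Z\<close> of the center, an element \<open>X\<close> central modulo the \<open>R\<close>-span of \<open>Z\<close>, and
  an element \<open>Y\<close> central modulo the \<open>R\<close>-span of \<open>X\<close> and \<open>Z\<close>.  It is a basis of \<open>R L\<close> because it is
  independent and has as many elements as the rank.
\<close>

lemma embedding_corank_two:
  fixes L :: "('a::idom fract \<Rightarrow> 'a fract) set"
  assumes chain: "central_chain L S N" and deriv: "\<And>D. D \<in> L \<Longrightarrow> derivation D"
    and char0: "\<And>n. of_nat (Suc n) \<noteq> (0 :: 'a fract)"
    and fin: "finite_rank L" and rk: "rk L = Suc (Suc k)" and center: "k \<le> rk (center L)"
  shows "\<exists>\<phi>. lie_embedding (constants L) (span_over (constants L) L)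
               (triangular (Suc (Suc k)) (constants L)) \<phi>"
proof -
  interpret central_chain L S N by fact
  obtain Z where Z: "Z \<subseteq> center L" "fract_op.independent Z" "finite Z" "card Z = k"
    using subset_of_center_exists[OF center] by blast
  have ZL: "Z \<subseteq> L" using Z(1) by (auto simp: center_def)
  have "\<not> L \<subseteq> fract_op.span Z" using Z rk by (intro not_subset_span) auto
  then obtain X where X: "X \<in> L" "X \<notin> fract_op.span Z"
    and X_mod: "\<And>E. E \<in> L \<Longrightarrow> lie_bracket E X \<in> fract_op.span Z"
    using central_modulo[OF fract_op.span_zero] by blast
  have XZ: "X \<notin> Z" using X(2) fract_op.span_base by blast
  have "\<not> L \<subseteq> fract_op.span (insert X Z)" using Z rk XZ by (intro not_subset_span) auto
  then obtain Y where Y: "Y \<in> L" "Y \<notin> fract_op.span (insert X Z)"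
    and Y_mod: "\<And>E. E \<in> L \<Longrightarrow> lie_bracket E Y \<in> fract_op.span (insert X Z)"
    using central_modulo[OF fract_op.span_zero] by blast
  have YXZ: "Y \<notin> insert X Z" using Y(2) fract_op.span_base by blast
  have "fract_op.independent (insert Y (insert X Z))"
    using X(2) Y(2) Z(2) by (intro fract_op.independent_insertI)
  then have L_span: "L \<subseteq> fract_op.span (insert Y (insert X Z))"
    using Z XZ YXZ ZL X(1) Y(1) rk by (intro subset_span_of_independent fin) auto
  obtain B where B: "bij_betw B {1..k} Z" using ex_bij_betw_nat_finite_1[OF Z(3)] Z(4) by blast
  then have Z_eq: "Z = B ` {1..k}" by (simp add: bij_betw_def)
  have BZ: "B i \<in> Z" if "i \<in> {1..k}" for i using that Z_eq by blast
  have span_Z: "D \<in> fract_op.span Z \<longleftrightarrow> (\<exists>r. D = (\<lambda>z. \<Sum>i=1..k. r i * B i z))" for D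
    unfolding Z_eq by (rule in_span_image_iff) simp
  have span_XZ: "D \<in> fract_op.span (insert X Z) \<longleftrightarrow> (\<exists>s r. D = (\<lambda>z. s * X z + (\<Sum>i=1..k. r i * B i z)))" for D
    unfolding fract_op.span_insert mem_Collect_eq span_Z
    by (simp add: fun_eq_iff pointwise_mult_def diff_eq_eq add.commute)
  have span_YXZ: "D \<in> fract_op.span (insert Y (insert X Z)) \<longleftrightarrow>
      (\<exists>c s r. D = (\<lambda>z. c * Y z + s * X z + (\<Sum>i=1..k. r i * B i z)))" for D
    unfolding fract_op.span_insert[of Y] mem_Collect_eq span_XZ
    by (simp add: fun_eq_iff pointwise_mult_def diff_eq_eq add_ac)
  have skew: "lie_bracket D E = - lie_bracket E D" for D E :: "'a fract \<Rightarrow> 'a fract"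
    by (simp add: lie_bracket_def fun_eq_iff)
  have central: "lie_bracket (B i) E = 0" if "i \<in> {1..k}" "E \<in> L" for i E
    using BZ[OF that(1)] Z(1) that(2) by (auto simp: center_def)
  then have commute: "B i (E z) = E (B i z)" if "i \<in> {1..k}" "E \<in> L" for i E z
    using fun_cong[OF central[OF that], of z] by (simp add: lie_bracket_def)
  obtain g where g: "lie_bracket Y X = (\<lambda>z. \<Sum>i=1..k. g i * B i z)"
    using X_mod[OF Y(1)] span_Z by blast
  interpret derivation_frame k B X Y g
  proof
    show "Y (X z) = X (Y z) + (\<Sum>i=1..k. g i * B i z)" for z
      using fun_cong[OF g, of z] by (simp add: lie_bracket_def algebra_simps)
    fix c s r assume zero: "\<And>z. c * Y z + s * X z + (\<Sum>i=1..k. r i * B i z) = 0"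
    have c: "c = 0"
    proof (rule ccontr)
      assume "c \<noteq> 0"
      have eq: "Y z = (- (s / c)) * X z + (\<Sum>i=1..k. (- (r i / c)) * B i z)" for z
      proof -
        have "(\<Sum>i=1..k. (- (r i / c)) * B i z) = - ((\<Sum>i=1..k. r i * B i z) / c)"
          by (simp add: sum_negf sum_divide_distrib)
        also have "(\<Sum>i=1..k. r i * B i z) = - (c * Y z + s * X z)"
          by (rule minus_unique[OF zero, symmetric])
        finally show ?thesis using \<open>c \<noteq> 0\<close> by (simp add: field_simps)
      qed
      have "Y \<in> fract_op.span (insert X Z)"
        unfolding span_XZ
        by (rule exI[of _ "- (s / c)"], rule exI[of _ "\<lambda>i. - (r i / c)"], rule ext, rule eq)
      then show False using Y(2) by blast
    qed
    have s: "s = 0"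
    proof (rule ccontr)
      assume "s \<noteq> 0"
      have eq: "X z = (\<Sum>i=1..k. (- (r i / s)) * B i z)" for z
      proof -
        have "(\<Sum>i=1..k. (- (r i / s)) * B i z) = - ((\<Sum>i=1..k. r i * B i z) / s)"
          by (simp add: sum_negf sum_divide_distrib)
        also have "(\<Sum>i=1..k. r i * B i z) = - (s * X z)"
          by (rule minus_unique[symmetric]) (use zero[of z] c in simp)
        finally show ?thesis using \<open>s \<noteq> 0\<close> by (simp add: field_simps)
      qed
      have "X \<in> fract_op.span Z"
        unfolding span_Z by (rule exI[of _ "\<lambda>i. - (r i / s)"], rule ext, rule eq)
      then show False using X(2) by blast
    qed
    have inj: "inj_on B {1..k}" using B by (simp add: bij_betw_def)
    have "(\<Sum>D\<in>Z. pointwise_mult (r (the_inv_into {1..k} B D)) D) =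
        (\<Sum>i=1..k. pointwise_mult (r i) (B i))"
      unfolding Z_eq by (simp add: sum.reindex[OF inj] the_inv_into_f_f[OF inj] del: One_nat_def)
    also have "\<dots> = 0"
    proof -
      have "(\<Sum>i\<in>I. pointwise_mult (r i) (B i)) z = (\<Sum>i\<in>I. r i * B i z)" for I z
        by (induction I rule: infinite_finite_induct) (auto simp: pointwise_mult_def)
      then show ?thesis using zero c s by (simp add: fun_eq_iff)
    qed
    finally have sum_zero: "(\<Sum>D\<in>Z. pointwise_mult (r (the_inv_into {1..k} B D)) D) = 0" .
    have "r i = 0" if "i \<in> {1..k}" for i
      using fract_op.independentD[OF Z(2,3) subset_refl sum_zero BZ[OF that]]
      by (simp only: the_inv_into_f_f[OF inj that])
    then show "c = 0 \<and> s = 0 \<and> (\<forall>i\<in>{1..k}. r i = 0)" using c s by blast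
  next
    have BL: "B i \<in> L" if "i \<in> {1..k}" for i using BZ[OF that] ZL by blast
    show "derivation (B i)" if "i \<in> {1..k}" for i using deriv[OF BL[OF that]] .
    show "B i (B j z) = B j (B i z)" if "i \<in> {1..k}" "j \<in> {1..k}" for i j z
      using commute[OF that(1) BL[OF that(2)]] .
    show "B i (X z) = X (B i z)" if "i \<in> {1..k}" for i z using commute[OF that X(1)] .
    show "B i (Y z) = Y (B i z)" if "i \<in> {1..k}" for i z using commute[OF that Y(1)] .
  qed (rule char0, rule deriv[OF X(1)], rule deriv[OF Y(1)])
  interpret nilpotent_frame k B X Y g L S N
  proof
    fix E assume E: "E \<in> L"
    have "lie_bracket X E \<in> fract_op.span Z"
      using fract_op.span_neg[OF X_mod[OF E]] skew[of X E] by simp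
    then show "\<exists>r. lie_bracket X E = comb 0 0 r" by (simp add: span_Z comb_def)
    have "lie_bracket Y E \<in> fract_op.span (insert X Z)"
      using fract_op.span_neg[OF Y_mod[OF E]] skew[of Y E] by simp
    then show "\<exists>s r. lie_bracket Y E = comb 0 s r" by (simp add: span_XZ comb_def)
    show "\<exists>c s r. E = comb c s r" using L_span E span_YXZ by (auto simp: comb_def)
    show "lie_bracket (B i) E = 0" if "i \<in> {1..k}" for i using central that E by blast
  qed (use X Y BZ ZL in blast)+
  show ?thesis by (rule embedding)
qed

theorem theorem2:
  fixes sc :: "'k::field_char_0 \<Rightarrow> 'a::idom \<Rightarrow> 'a"
    and L :: "('a fract \<Rightarrow> 'a fract) set"
    and n :: nat
  assumes "algebra_over_field sc"
    and "lie_subalgebra sc (W sc) L"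
    and "nilpotent sc L"
    and "finite_rank L" and "rk L = n"
    and "int (rk (center L)) \<ge> int n - 2"
  shows "\<exists>\<phi>. lie_embedding (constants L) (span_over (constants L) L)
                (triangular n (constants L)) \<phi>"
proof -
  obtain N where "lower_central_series sc L N = {0}" using assms(3) by (auto simp: nilpotent_def)
  then have chain: "central_chain L (lower_central_series sc L) N"
    by (rule lower_central_series_chain[OF assms(1,2)])
  have deriv: "derivation D" if "D \<in> L" for D
    using that assms(2) W_derivation by (auto simp: lie_subalgebra_def)
  show ?thesis
  proof (cases "n \<le> 1")
    case True
    show ?thesis
      using embedding_rank_at_most_one[OF chain deriv assms(4)] True unfolding assms(5) by simp
  next
    case False
    then obtain k where n: "n = Suc (Suc k)" by (metis One_nat_def Suc_le_mono less_eq_nat.simps(1) not0_implies_Suc)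
    show ?thesis
      unfolding n
      by (rule embedding_corank_two[OF chain deriv of_nat_fract_neq_zero[OF assms(1)] assms(4)])
         (use assms(5,6) n in auto)
  qed
qed

end
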